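(* Let $R$ be a noetherian domain of dimension $1$. Let $I=(f_1,\ldots,f_n)\neq 0$ be an ideal of $R$, $f\in R$ an element, and $A=R[T_1,\ldots,T_n]/(f_1T_1+\cdots+f_nT_n+f)$ the forcing algebra for these data. Then $\operatorname{Spec} A$ is connected if and only if $\operatorname{Spec} A$ is locally connected over the base, i.e. for every prime ideal $\mathfrak p\in\operatorname{Spec} R$ the spectrum of $A_{R\setminus\mathfrak p}$ is connected.
   Context: $A_{R\setminus\mathfrak p}$ is the localization of $A$ at the image of the multiplicative system $R\setminus\mathfrak p$. The empty topological space is not considered connected. *)

theory Defs
  imports
    "HOL-Algebra.Ring_Divisibility"
    "HOL-Algebra.Indexed_Polynomials"
    "HOL-Analysis.Abstract_Topology"
    "HOL-Library.Extended_Nat"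
begin

section \<open>Krull dimension\<close>

text \<open>The supremum of the lengths of chains of prime ideals. The zero ring gets dimension 0,
  the bottom element of \<^typ>\<open>enat\<close>; for domains this case does not occur.\<close>

definition krull_dim :: "('a, 'b) ring_scheme \<Rightarrow> enat" where
  "krull_dim R = (SUP d \<in> {d. \<exists>P :: nat \<Rightarrow> 'a set.
      (\<forall>i\<le>d. primeideal (P i) R) \<and> (\<forall>i<d. P i \<subset> P (Suc i))}. enat d)"


section \<open>The spectrum with the Zariski topology\<close>

definition zariski :: "('a, 'b) ring_scheme \<Rightarrow> 'a set topology" where
  "zariski A = topology (\<lambda>U. \<exists>E \<subseteq> carrier A. U = {P. primeideal P A \<and> \<not> E \<subseteq> P})"

lemma istopology_zariski:
  assumes "ring A"
  shows "istopology (\<lambda>U. \<exists>E \<subseteq> carrier A. U = {P. primeideal P A \<and> \<not> E \<subseteq> P})"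
proof -
  have inter: "\<exists>E \<subseteq> carrier A. {P. primeideal P A \<and> \<not> E1 \<subseteq> P} \<inter> {P. primeideal P A \<and> \<not> E2 \<subseteq> P}
      = {P. primeideal P A \<and> \<not> E \<subseteq> P}"
    if E: "E1 \<subseteq> carrier A" "E2 \<subseteq> carrier A" for E1 E2
  proof (intro exI conjI)
    let ?E = "(\<lambda>(x, y). x \<otimes>\<^bsub>A\<^esub> y) ` (E1 \<times> E2)"
    interpret ring A by fact
    show "?E \<subseteq> carrier A" using E by auto
    have "(\<not> E1 \<subseteq> P \<and> \<not> E2 \<subseteq> P) \<longleftrightarrow> \<not> ?E \<subseteq> P" if P: "primeideal P A" for P
    proof -
      interpret primeideal P A by fact
      have *: "x \<otimes>\<^bsub>A\<^esub> y \<in> P" if "x \<in> E1" "y \<in> E2" "x \<in> P \<or> y \<in> P" for x y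
        using that E I_l_closed I_r_closed by (metis subsetD)
      show ?thesis
      proof
        assume "\<not> E1 \<subseteq> P \<and> \<not> E2 \<subseteq> P"
        then obtain x y where "x \<in> E1" "y \<in> E2" "x \<notin> P" "y \<notin> P" by auto
        then show "\<not> ?E \<subseteq> P" using I_prime[of x y] E by force
      qed (use * in force)
    qed
    then show "{P. primeideal P A \<and> \<not> E1 \<subseteq> P} \<inter> {P. primeideal P A \<and> \<not> E2 \<subseteq> P}
        = {P. primeideal P A \<and> \<not> ?E \<subseteq> P}"
      by blast
  qed
  have union: "\<exists>E \<subseteq> carrier A. \<Union>K = {P. primeideal P A \<and> \<not> E \<subseteq> P}"
    if K: "\<forall>U\<in>K. \<exists>E \<subseteq> carrier A. U = {P. primeideal P A \<and> \<not> E \<subseteq> P}" for K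
  proof -
    from K obtain e where e: "\<And>U. U \<in> K \<Longrightarrow> e U \<subseteq> carrier A"
        "\<And>U. U \<in> K \<Longrightarrow> U = {P. primeideal P A \<and> \<not> e U \<subseteq> P}"
      by metis
    have "P \<in> \<Union>K \<longleftrightarrow> primeideal P A \<and> \<not> \<Union>(e ` K) \<subseteq> P" for P
    proof -
      have "P \<in> U \<longleftrightarrow> primeideal P A \<and> \<not> e U \<subseteq> P" if "U \<in> K" for U
        using e(2)[OF that] by blast
      then show ?thesis by (auto simp: UN_subset_iff)
    qed
    then have "\<Union>K = {P. primeideal P A \<and> \<not> \<Union>(e ` K) \<subseteq> P}" by blast
    moreover have "\<Union>(e ` K) \<subseteq> carrier A" using e(1) by blast
    ultimately show ?thesis by blast
  qed
  show ?thesis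
    unfolding istopology_def using inter union by clarsimp
qed

lemma openin_zariski:
  assumes "ring A"
  shows "openin (zariski A) U \<longleftrightarrow> (\<exists>E \<subseteq> carrier A. U = {P. primeideal P A \<and> \<not> E \<subseteq> P})"
  unfolding zariski_def using istopology_zariski[OF assms] by simp

lemma topspace_zariski:
  assumes "ring A"
  shows "topspace (zariski A) = {P. primeideal P A}"
proof
  show "topspace (zariski A) \<subseteq> {P. primeideal P A}"
    using openin_topspace[of "zariski A"] unfolding openin_zariski[OF assms] by blast
  have "P \<noteq> carrier A" "P \<subseteq> carrier A" if "primeideal P A" for P
    using primeideal.I_notcarr[OF that] ideal.Icarr[OF primeideal.axioms(1)[OF that]] by blast+
  then have "{P. primeideal P A} = {P. primeideal P A \<and> \<not> carrier A \<subseteq> P}" by blast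
  then have "openin (zariski A) {P. primeideal P A}"
    unfolding openin_zariski[OF assms] by blast
  then show "{P. primeideal P A} \<subseteq> topspace (zariski A)"
    by (rule openin_subset)
qed

text \<open>\<^const>\<open>connected_space\<close> holds for the empty space, which is not connected here.\<close>

definition connected_spec :: "('a, 'b) ring_scheme \<Rightarrow> bool" where
  "connected_spec A \<longleftrightarrow> connected_space (zariski A) \<and> topspace (zariski A) \<noteq> {}"


section \<open>Localization\<close>

text \<open>For a multiplicative system \<open>S\<close> in a commutative ring \<open>A\<close>, the fraction \<open>a / s\<close> is the class of all
  pairs \<open>(b, t)\<close> with \<open>u (t a - s b) = 0\<close> for some \<open>u \<in> S\<close>; zero divisors in \<open>S\<close> are allowed.\<close>

definition fraction :: "('a, 'b) ring_scheme \<Rightarrow> 'a set \<Rightarrow> 'a \<Rightarrow> 'a \<Rightarrow> ('a \<times> 'a) set" where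
  "fraction A S a s = {(b, t) \<in> carrier A \<times> S.
      \<exists>u\<in>S. u \<otimes>\<^bsub>A\<^esub> (t \<otimes>\<^bsub>A\<^esub> a \<ominus>\<^bsub>A\<^esub> s \<otimes>\<^bsub>A\<^esub> b) = \<zero>\<^bsub>A\<^esub>}"

definition localization :: "('a, 'b) ring_scheme \<Rightarrow> 'a set \<Rightarrow> ('a \<times> 'a) set ring" where
  "localization A S =
    \<lparr>carrier = {fraction A S a s |a s. a \<in> carrier A \<and> s \<in> S},
     monoid.mult = (\<lambda>B C. \<Union>{fraction A S (a \<otimes>\<^bsub>A\<^esub> b) (s \<otimes>\<^bsub>A\<^esub> t)
       |a s b t. (a, s) \<in> B \<and> (b, t) \<in> C}),
     one = fraction A S \<one>\<^bsub>A\<^esub> \<one>\<^bsub>A\<^esub>,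
     zero = fraction A S \<zero>\<^bsub>A\<^esub> \<one>\<^bsub>A\<^esub>,
     add = (\<lambda>B C. \<Union>{fraction A S (t \<otimes>\<^bsub>A\<^esub> a \<oplus>\<^bsub>A\<^esub> s \<otimes>\<^bsub>A\<^esub> b) (s \<otimes>\<^bsub>A\<^esub> t)
       |a s b t. (a, s) \<in> B \<and> (b, t) \<in> C})\<rparr>"

text \<open>Here \<open>\<phi>\<close> is the structure map of the \<open>R\<close>-algebra \<open>A\<close>.\<close>

definition locally_connected_over ::
    "('r, 'b) ring_scheme \<Rightarrow> ('r \<Rightarrow> 'a) \<Rightarrow> ('a, 'c) ring_scheme \<Rightarrow> bool" where
  "locally_connected_over R \<phi> A \<longleftrightarrow>
    (\<forall>\<pp>. primeideal \<pp> R \<longrightarrow> connected_spec (localization A (\<phi> ` (carrier R - \<pp>))))"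


section \<open>Polynomial rings and forcing algebras\<close>

text \<open>The library provides the set of polynomials over \<open>R\<close> in variables indexed by \<open>I\<close> (as
  functions from monomials, which are multisets of variables, to coefficients), but no product
  of two such polynomials. It is given here by convolution.\<close>

definition mpoly_mult ::
    "('a, 'b) ring_scheme \<Rightarrow> ('c multiset \<Rightarrow> 'a) \<Rightarrow> ('c multiset \<Rightarrow> 'a) \<Rightarrow> 'c multiset \<Rightarrow> 'a" where
  "mpoly_mult R p q = (\<lambda>m. finsum R (\<lambda>(k, l). p k \<otimes>\<^bsub>R\<^esub> q l) {(k, l). k + l = m})"

definition mpoly_ring :: "('a, 'b) ring_scheme \<Rightarrow> 'c set \<Rightarrow> ('c multiset \<Rightarrow> 'a) ring" where
  "mpoly_ring R I =
    \<lparr>carrier = ring.indexed_pset R I (carrier R),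
     monoid.mult = mpoly_mult R,
     one = ring.indexed_const R \<one>\<^bsub>R\<^esub>,
     zero = ring.indexed_const R \<zero>\<^bsub>R\<^esub>,
     add = ring.indexed_padd R\<rparr>"

definition forcing_polynomial ::
    "('a, 'b) ring_scheme \<Rightarrow> nat \<Rightarrow> (nat \<Rightarrow> 'a) \<Rightarrow> 'a \<Rightarrow> (nat multiset \<Rightarrow> 'a)" where
  "forcing_polynomial R n f g =
    (let P = mpoly_ring R {1..n} in
      (\<Oplus>\<^bsub>P\<^esub>i\<in>{1..n}. ring.indexed_const R (f i) \<otimes>\<^bsub>P\<^esub> ring.indexed_var R i)
        \<oplus>\<^bsub>P\<^esub> ring.indexed_const R g)"

definition forcing_ideal ::
    "('a, 'b) ring_scheme \<Rightarrow> nat \<Rightarrow> (nat \<Rightarrow> 'a) \<Rightarrow> 'a \<Rightarrow> (nat multiset \<Rightarrow> 'a) set" where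
  "forcing_ideal R n f g = Idl\<^bsub>mpoly_ring R {1..n}\<^esub> {forcing_polynomial R n f g}"

definition forcing_algebra ::
    "('a, 'b) ring_scheme \<Rightarrow> nat \<Rightarrow> (nat \<Rightarrow> 'a) \<Rightarrow> 'a \<Rightarrow> (nat multiset \<Rightarrow> 'a) set ring" where
  "forcing_algebra R n f g = mpoly_ring R {1..n} Quot forcing_ideal R n f g"

definition forcing_map ::
    "('a, 'b) ring_scheme \<Rightarrow> nat \<Rightarrow> (nat \<Rightarrow> 'a) \<Rightarrow> 'a \<Rightarrow> 'a \<Rightarrow> (nat multiset \<Rightarrow> 'a) set" where
  "forcing_map R n f g r =
    forcing_ideal R n f g +>\<^bsub>mpoly_ring R {1..n}\<^esub> ring.indexed_const R r"

end

theory Submission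
  imports Defs "HOL-Library.Multiset_Order"
begin

text \<open>
  Let \<open>A\<close> be the forcing algebra and \<open>T\<close> the set of its elements killed by some nonzero element of
  \<open>R\<close>. Some \<open>f\<^sub>i\<close> is nonzero, and wherever \<open>f\<^sub>i\<close> becomes invertible the equation
  \<open>\<Sum> f\<^sub>i T\<^sub>i + g = 0\<close> can be solved for \<open>T\<^sub>i\<close>, which turns \<open>A\<close> into a polynomial ring in the remaining
  variables. Two facts follow. First, \<open>T\<close> is a prime ideal: it is the generic point of the closure of
  the generic fibre (\<open>torsion_primeideal\<close>). Second, a prime of \<open>A\<close> that does not contain \<open>T\<close> must lie
  over a prime \<open>\<pp>\<close> of \<open>R\<close> that contains all \<open>f\<^sub>i\<close> and then also \<open>g\<close>. Over such a \<open>\<pp>\<close> the equation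
  disappears, and the fibre is the affine space over the residue field; it has a generic point, the
  extension of \<open>\<pp>\<close> (\<open>generic_prime_of_fibre\<close>). So \<open>Spec A\<close> consists of one horizontal piece, the
  primes above \<open>T\<close>, and of whole vertical fibres over certain closed points of \<open>Spec R\<close>.

  The rest of the argument uses only this picture of \<open>Spec A\<close> and is carried out for an arbitrary
  \<open>R\<close>-algebra having it. The connected set of primes above \<open>T\<close> is visible in \<open>A\<close> and in each of its
  localizations. If \<open>Spec A\<close> splits into two nonempty closed parts, one of them contains \<open>T\<close>; choose \<open>Q\<close> in the
  other one and let \<open>\<pp>\<close> be the prime of \<open>R\<close> under \<open>Q\<close>. Both \<open>T\<close> and \<open>Q\<close> survive in \<open>A\<^sub>\<pp>\<close>, so that
  \<open>Spec A\<^sub>\<pp>\<close> is split as well (\<open>disconnected_localization\<close>). Conversely, suppose that \<open>Spec A\<^sub>\<pp>\<close>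
  splits. Then the part without \<open>T\<close> is the fibre over \<open>\<pp>\<close>, with generic point \<open>Q\<^sub>0\<close> say, and it does not
  meet the horizontal piece, so \<open>1 = y + x\<close> with \<open>y \<in> T\<close> and \<open>x \<in> Q\<^sub>0\<close>. Let \<open>r \<noteq> 0\<close>
  be such that \<open>r y = 0\<close>. Then \<open>y\<close> vanishes at all points of \<open>Spec A\<close> except over primes that contain
  \<open>r\<close>. As \<open>R\<close> is noetherian of dimension one, there are finitely many of these, and some \<open>s \<notin> \<pp>\<close> lies in
  all of them except \<open>\<pp>\<close> (\<open>separating_element\<close>). So the open set where \<open>s y\<close> does not vanish is exactly the fibre over
  \<open>\<pp>\<close>, which is therefore open and closed in \<open>Spec A\<close> (\<open>disconnected_global\<close>).
\<close>


section \<open>Connectedness of the spectrum in terms of prime ideals\<close>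

lemma prime_one_notin:
  assumes "primeideal Q R"
  shows "\<one>\<^bsub>R\<^esub> \<notin> Q"
proof
  interpret primeideal Q R by fact
  assume "\<one>\<^bsub>R\<^esub> \<in> Q"
  then have "Q = carrier R" by (rule one_imp_carrier)
  then show False using I_notcarr by simp
qed

lemma (in ring_hom_cring) primeideal_vimage:
  assumes Q: "primeideal Q S"
  shows "primeideal {r \<in> carrier R. h r \<in> Q} R"
proof -
  interpret Q: primeideal Q S by fact
  have one: "\<one> \<notin> {r \<in> carrier R. h r \<in> Q}" using prime_one_notin[OF Q] by simp
  show ?thesis
  proof (rule primeidealI[OF _ R.cring_axioms])
    show "ideal {r \<in> carrier R. h r \<in> Q} R" by (rule ring.ideal_vimage[OF Q.ideal_axioms])
    show "carrier R \<noteq> {r \<in> carrier R. h r \<in> Q}" using one R.one_closed by blast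
    fix a b assume ab: "a \<in> carrier R" "b \<in> carrier R" "a \<otimes> b \<in> {r \<in> carrier R. h r \<in> Q}"
    then have "h a \<otimes>\<^bsub>S\<^esub> h b \<in> Q" by simp
    then have "h a \<in> Q \<or> h b \<in> Q" using ab by (intro Q.I_prime) auto
    then show "a \<in> {r \<in> carrier R. h r \<in> Q} \<or> b \<in> {r \<in> carrier R. h r \<in> Q}" using ab by simp
  qed
qed

text \<open>The closed sets \<open>V(E1)\<close> and \<open>V(E2)\<close> are complementary and nonempty. Stating this about prime ideals
  removes the topology from all later arguments.\<close>

definition disconnects :: "('a, 'b) ring_scheme \<Rightarrow> 'a set \<Rightarrow> 'a set \<Rightarrow> bool" where
  "disconnects A E1 E2 \<longleftrightarrow> E1 \<subseteq> carrier A \<and> E2 \<subseteq> carrier A \<and>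
    (\<forall>P. primeideal P A \<longrightarrow> (E1 \<subseteq> P \<longleftrightarrow> \<not> E2 \<subseteq> P)) \<and>
    (\<exists>P. primeideal P A \<and> E1 \<subseteq> P) \<and> (\<exists>P. primeideal P A \<and> E2 \<subseteq> P)"

lemma disconnectsD:
  assumes "disconnects A E1 E2"
  shows "E1 \<subseteq> carrier A" "E2 \<subseteq> carrier A"
    and "primeideal P A \<Longrightarrow> E1 \<subseteq> P \<longleftrightarrow> \<not> E2 \<subseteq> P"
    and "\<exists>P. primeideal P A \<and> E1 \<subseteq> P" "\<exists>P. primeideal P A \<and> E2 \<subseteq> P"
  using assms unfolding disconnects_def by blast+

lemma disconnects_sym:
  assumes "disconnects A E1 E2"
  shows "disconnects A E2 E1"
  using assms unfolding disconnects_def by blast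

lemma connected_spec_iff:
  assumes "ring A"
  shows "connected_spec A \<longleftrightarrow> (\<exists>P. primeideal P A) \<and> (\<nexists>E1 E2. disconnects A E1 E2)"
proof -
  let ?V = "\<lambda>E. {P. primeideal P A \<and> \<not> E \<subseteq> P}"
  have split: "?V E1 \<union> ?V E2 = {P. primeideal P A} \<and> ?V E1 \<inter> ?V E2 = {} \<and> ?V E1 \<noteq> {} \<and> ?V E2 \<noteq> {}
      \<longleftrightarrow> disconnects A E1 E2" if "E1 \<subseteq> carrier A" "E2 \<subseteq> carrier A" for E1 E2
  proof -
    have *: "{P. r P \<and> \<not> p P} \<union> {P. r P \<and> \<not> q P} = {P. r P} \<and>
        {P. r P \<and> \<not> p P} \<inter> {P. r P \<and> \<not> q P} = {} \<and> {P. r P \<and> \<not> p P} \<noteq> {} \<and> {P. r P \<and> \<not> q P} \<noteq> {}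
      \<longleftrightarrow> (\<forall>P. r P \<longrightarrow> p P = (\<not> q P)) \<and> (\<exists>P. r P \<and> p P) \<and> (\<exists>P. r P \<and> q P)"
      for p q r :: "'a set \<Rightarrow> bool" by blast
    show ?thesis unfolding disconnects_def * using that by simp
  qed
  have "\<not> connected_space (zariski A) \<longleftrightarrow> (\<exists>E1 E2. disconnects A E1 E2)"
  proof
    assume "\<not> connected_space (zariski A)"
    then obtain U V where UV: "openin (zariski A) U" "openin (zariski A) V"
      "U \<union> V = {P. primeideal P A}" "U \<inter> V = {}" "U \<noteq> {}" "V \<noteq> {}"
      unfolding connected_space_eq topspace_zariski[OF assms] not_not by (elim exE conjE)
    obtain E1 where E1: "E1 \<subseteq> carrier A" "U = ?V E1"
      using UV(1) unfolding openin_zariski[OF assms] by (elim exE conjE)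
    obtain E2 where E2: "E2 \<subseteq> carrier A" "V = ?V E2"
      using UV(2) unfolding openin_zariski[OF assms] by (elim exE conjE)
    have "disconnects A E1 E2"
      using UV(3-6) split[OF E1(1) E2(1)] unfolding E1(2) E2(2) by simp
    then show "\<exists>E1 E2. disconnects A E1 E2" by blast
  next
    assume "\<exists>E1 E2. disconnects A E1 E2"
    then obtain E1 E2 where D: "disconnects A E1 E2" by (elim exE)
    note E = disconnectsD(1,2)[OF D]
    have "openin (zariski A) (?V E1)"
      unfolding openin_zariski[OF assms] using E(1) by (intro exI[of _ E1] conjI refl)
    moreover have "openin (zariski A) (?V E2)"
      unfolding openin_zariski[OF assms] using E(2) by (intro exI[of _ E2] conjI refl)
    moreover have "?V E1 \<union> ?V E2 = {P. primeideal P A} \<and> ?V E1 \<inter> ?V E2 = {} \<and> ?V E1 \<noteq> {} \<and> ?V E2 \<noteq> {}"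
      using D split[OF E] by (rule iffD2[rotated])
    ultimately show "\<not> connected_space (zariski A)"
      unfolding connected_space_eq topspace_zariski[OF assms] not_not by (intro exI[of _ "?V E1"] exI[of _ "?V E2"] conjI) simp_all
  qed
  moreover have "topspace (zariski A) \<noteq> {} \<longleftrightarrow> (\<exists>P. primeideal P A)"
    unfolding topspace_zariski[OF assms] by simp
  ultimately show ?thesis unfolding connected_spec_def by blast
qed

lemma (in cring) exists_prime_above:
  assumes I: "ideal I R" "\<one> \<notin> I"
  shows "\<exists>Q. primeideal Q R \<and> I \<subseteq> Q"
proof -
  let ?\<A> = "{J. ideal J R \<and> I \<subseteq> J \<and> \<one> \<notin> J}"
  have "\<exists>M\<in>?\<A>. \<forall>J\<in>?\<A>. M \<subseteq> J \<longrightarrow> J = M"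
  proof (rule subset_Zorn_nonempty)
    show "?\<A> \<noteq> {}" using I by blast
    fix \<C> assume \<C>: "\<C> \<noteq> {}" "subset.chain ?\<A> \<C>"
    then have "subset.chain {J. ideal J R} \<C>" unfolding pred_on.chain_def by blast
    then have "ideal (\<Union>\<C>) R" using chain_Union_is_ideal \<C>(1) by presburger
    moreover have "I \<subseteq> \<Union>\<C>" "\<one> \<notin> \<Union>\<C>" using \<C> unfolding pred_on.chain_def by blast+
    ultimately show "\<Union>\<C> \<in> ?\<A>" by blast
  qed
  then obtain M where "M \<in> ?\<A>" and M_max: "\<forall>J\<in>?\<A>. M \<subseteq> J \<longrightarrow> J = M" by (elim bexE)
  then have M: "ideal M R" "I \<subseteq> M" "\<one> \<notin> M" by simp_all
  have max: "J = M" if "ideal J R" "\<one> \<notin> J" "M \<subseteq> J" for J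
    using M_max that M(2) by simp
  have "maximalideal M R"
  proof (rule maximalidealI)
    show "carrier R \<noteq> M" using M(3) one_closed by blast
    fix J assume J: "ideal J R" "M \<subseteq> J"
    show "J = M \<or> J = carrier R"
      using max[OF J(1) _ J(2)] ideal.one_imp_carrier[OF J(1)] by (cases "\<one> \<in> J") simp_all
  qed (rule M)
  then have "primeideal M R" by (rule maximalideal_prime)
  then show ?thesis using M(2) by blast
qed

text \<open>The algebraic form of disjointness: a proper ideal lies in a prime ideal, so closed sets without
  common point are defined by comaximal ideals.\<close>

lemma (in cring) comaximal_if_no_common_prime:
  assumes I: "ideal I R" and J: "ideal J R"
    and no_common: "\<And>Q. primeideal Q R \<Longrightarrow> \<not> (I \<subseteq> Q \<and> J \<subseteq> Q)"
  shows "\<exists>x\<in>I. \<exists>y\<in>J. \<one> = x \<oplus> y"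
proof -
  have sub: "I \<union> J \<subseteq> carrier R"
    using ideal.Icarr[OF I] ideal.Icarr[OF J] by blast
  have "\<one> \<in> Idl (I \<union> J)"
  proof (rule ccontr)
    assume "\<one> \<notin> Idl (I \<union> J)"
    from exists_prime_above[OF genideal_ideal[OF sub] this]
    obtain Q where "primeideal Q R" "Idl (I \<union> J) \<subseteq> Q" by (elim exE conjE)
    moreover have "I \<union> J \<subseteq> Idl (I \<union> J)" using sub by (rule genideal_self)
    ultimately have "primeideal Q R" "I \<union> J \<subseteq> Q" by (simp, meson subset_trans)
    then show False using no_common[of Q] by simp
  qed
  then have "\<one> \<in> I <+> J" unfolding union_genideal[OF I J] .
  then show ?thesis unfolding set_add_def' by simp
qed

section \<open>Primes of a localization\<close>

locale multiplicative_system = cring A for A :: "('a, 'b) ring_scheme" (structure) +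
  fixes S :: "'a set"
  assumes S_subset: "S \<subseteq> carrier A"
    and one_in_S: "\<one> \<in> S"
    and S_mult: "\<And>s t. s \<in> S \<Longrightarrow> t \<in> S \<Longrightarrow> s \<otimes> t \<in> S"
begin

abbreviation "frc \<equiv> fraction A S"
abbreviation "L \<equiv> localization A S"

lemma S_carrier [simp]: "s \<in> S \<Longrightarrow> s \<in> carrier A"
  using S_subset by blast

lemma fraction_mem_iff:
  assumes "a \<in> carrier A" "s \<in> S"
  shows "(b, t) \<in> frc a s \<longleftrightarrow>
    b \<in> carrier A \<and> t \<in> S \<and> (\<exists>u\<in>S. u \<otimes> (t \<otimes> a) = u \<otimes> (s \<otimes> b))"
proof -
  have "u \<otimes> (t \<otimes> a \<ominus> s \<otimes> b) = \<zero> \<longleftrightarrow> u \<otimes> (t \<otimes> a) = u \<otimes> (s \<otimes> b)"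
    if "u \<in> S" "b \<in> carrier A" "t \<in> S" for u
  proof -
    have "u \<otimes> (t \<otimes> a \<ominus> s \<otimes> b) = u \<otimes> (t \<otimes> a) \<ominus> u \<otimes> (s \<otimes> b)"
      using that assms by (simp add: minus_eq r_distr r_minus)
    then show ?thesis using that assms by simp
  qed
  then show ?thesis unfolding fraction_def by blast
qed

lemma fraction_self:
  assumes "a \<in> carrier A" "s \<in> S"
  shows "(a, s) \<in> frc a s"
  using assms one_in_S fraction_mem_iff[OF assms, of a s] by blast

lemma fraction_sym:
  assumes "a \<in> carrier A" "s \<in> S" "(b, t) \<in> frc a s"
  shows "(a, s) \<in> frc b t"
proof -
  from assms obtain u where bt: "b \<in> carrier A" "t \<in> S" and u: "u \<in> S" "u \<otimes> (t \<otimes> a) = u \<otimes> (s \<otimes> b)"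
    using fraction_mem_iff[OF assms(1,2)] by auto
  then show ?thesis using assms(1,2) fraction_mem_iff[OF bt] by metis
qed

lemma fraction_trans:
  assumes "a \<in> carrier A" "s \<in> S" "(b, t) \<in> frc a s" "(c, w) \<in> frc b t"
  shows "(c, w) \<in> frc a s"
proof -
  from assms obtain u where b: "b \<in> carrier A" "t \<in> S" and u: "u \<in> S" "u \<otimes> (t \<otimes> a) = u \<otimes> (s \<otimes> b)"
    using fraction_mem_iff by metis
  with assms(4) obtain v where c: "c \<in> carrier A" "w \<in> S" and v: "v \<in> S" "v \<otimes> (w \<otimes> b) = v \<otimes> (t \<otimes> c)"
    using fraction_mem_iff by metis
  note carr = assms(1,2) b c u(1) v(1)
  \<comment> \<open>As \<open>S\<close> may contain zero divisors, \<open>t\<close> cannot be cancelled; it joins the witness.\<close>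
  have "(u \<otimes> v \<otimes> t) \<otimes> (w \<otimes> a) = (v \<otimes> w) \<otimes> (u \<otimes> (t \<otimes> a))"
    using carr by (simp add: m_ac)
  also have "\<dots> = (u \<otimes> s) \<otimes> (v \<otimes> (w \<otimes> b))"
    unfolding u(2) using carr by (simp add: m_ac)
  also have "\<dots> = (u \<otimes> v \<otimes> t) \<otimes> (s \<otimes> c)"
    unfolding v(2) using carr by (simp add: m_ac)
  finally have "(u \<otimes> v \<otimes> t) \<otimes> (w \<otimes> a) = (u \<otimes> v \<otimes> t) \<otimes> (s \<otimes> c)" .
  moreover have "u \<otimes> v \<otimes> t \<in> S" using carr S_mult by simp
  ultimately show ?thesis using fraction_mem_iff[OF assms(1,2)] c by blast
qed

lemma fraction_eqI:
  assumes "a \<in> carrier A" "s \<in> S" "(b, t) \<in> frc a s"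
  shows "frc b t = frc a s"
proof -
  have bt: "b \<in> carrier A" "t \<in> S" using assms fraction_mem_iff by blast+
  show ?thesis
    using fraction_trans[OF assms] fraction_trans[OF bt fraction_sym[OF assms]] by auto
qed

lemma fraction_eq_iff:
  assumes "a \<in> carrier A" "s \<in> S" "b \<in> carrier A" "t \<in> S"
  shows "frc a s = frc b t \<longleftrightarrow> (\<exists>u\<in>S. u \<otimes> (t \<otimes> a) = u \<otimes> (s \<otimes> b))"
  using fraction_eqI[OF assms(1,2), of b t] fraction_self[OF assms(3,4)]
    fraction_mem_iff[OF assms(1,2), of b t] assms by auto

lemma fraction_scale:
  assumes "a \<in> carrier A" "s \<in> S" "t \<in> S"
  shows "frc (t \<otimes> a) (t \<otimes> s) = frc a s"
proof -
  have "\<one> \<otimes> (s \<otimes> (t \<otimes> a)) = \<one> \<otimes> (t \<otimes> s \<otimes> a)" using assms by (simp add: m_ac)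
  then show ?thesis
    using assms one_in_S S_mult fraction_eq_iff[of "t \<otimes> a" "t \<otimes> s" a s] by auto
qed

lemma mult_fraction:
  assumes a: "a \<in> carrier A" "s \<in> S" and b: "b \<in> carrier A" "t \<in> S"
  shows "frc a s \<otimes>\<^bsub>L\<^esub> frc b t = frc (a \<otimes> b) (s \<otimes> t)"
proof -
  have eq: "frc (a' \<otimes> b') (s' \<otimes> t') = frc (a \<otimes> b) (s \<otimes> t)"
    if "(a', s') \<in> frc a s" "(b', t') \<in> frc b t" for a' s' b' t'
  proof -
    from that(1) obtain u where a': "a' \<in> carrier A" "s' \<in> S" and u: "u \<in> S" "u \<otimes> (s' \<otimes> a) = u \<otimes> (s \<otimes> a')"
      using fraction_mem_iff[OF a] by metis
    from that(2) obtain v where b': "b' \<in> carrier A" "t' \<in> S" and v: "v \<in> S" "v \<otimes> (t' \<otimes> b) = v \<otimes> (t \<otimes> b')"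
      using fraction_mem_iff[OF b] by metis
    note carr = a b a' b' u(1) v(1)
    have "(u \<otimes> v) \<otimes> ((s' \<otimes> t') \<otimes> (a \<otimes> b)) = (u \<otimes> (s' \<otimes> a)) \<otimes> (v \<otimes> (t' \<otimes> b))"
      using carr by (simp add: m_ac)
    also have "\<dots> = (u \<otimes> v) \<otimes> ((s \<otimes> t) \<otimes> (a' \<otimes> b'))"
      unfolding u(2) v(2) using carr by (simp add: m_ac)
    finally have "(a' \<otimes> b', s' \<otimes> t') \<in> frc (a \<otimes> b) (s \<otimes> t)"
      using carr S_mult by (subst fraction_mem_iff) auto
    then show ?thesis using carr S_mult by (intro fraction_eqI) auto
  qed
  have "{frc (a' \<otimes> b') (s' \<otimes> t') |a' s' b' t'. (a', s') \<in> frc a s \<and> (b', t') \<in> frc b t}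
      = {frc (a \<otimes> b) (s \<otimes> t)}"
    using eq fraction_self[OF a] fraction_self[OF b] by blast
  then show ?thesis unfolding localization_def by simp
qed

lemma add_fraction:
  assumes a: "a \<in> carrier A" "s \<in> S" and b: "b \<in> carrier A" "t \<in> S"
  shows "frc a s \<oplus>\<^bsub>L\<^esub> frc b t = frc (t \<otimes> a \<oplus> s \<otimes> b) (s \<otimes> t)"
proof -
  have eq: "frc (t' \<otimes> a' \<oplus> s' \<otimes> b') (s' \<otimes> t') = frc (t \<otimes> a \<oplus> s \<otimes> b) (s \<otimes> t)"
    if "(a', s') \<in> frc a s" "(b', t') \<in> frc b t" for a' s' b' t'
  proof -
    from that(1) obtain u where a': "a' \<in> carrier A" "s' \<in> S" and u: "u \<in> S" "u \<otimes> (s' \<otimes> a) = u \<otimes> (s \<otimes> a')"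
      using fraction_mem_iff[OF a] by metis
    from that(2) obtain v where b': "b' \<in> carrier A" "t' \<in> S" and v: "v \<in> S" "v \<otimes> (t' \<otimes> b) = v \<otimes> (t \<otimes> b')"
      using fraction_mem_iff[OF b] by metis
    note carr = a b a' b' u(1) v(1)
    have "(u \<otimes> v) \<otimes> ((s' \<otimes> t') \<otimes> (t \<otimes> a \<oplus> s \<otimes> b))
        = (v \<otimes> t' \<otimes> t) \<otimes> (u \<otimes> (s' \<otimes> a)) \<oplus> (u \<otimes> s' \<otimes> s) \<otimes> (v \<otimes> (t' \<otimes> b))"
      using carr by (simp add: m_ac r_distr)
    also have "\<dots> = (u \<otimes> v) \<otimes> ((s \<otimes> t) \<otimes> (t' \<otimes> a' \<oplus> s' \<otimes> b'))"
      unfolding u(2) v(2) using carr by (simp add: m_ac r_distr)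
    finally have "(t' \<otimes> a' \<oplus> s' \<otimes> b', s' \<otimes> t') \<in> frc (t \<otimes> a \<oplus> s \<otimes> b) (s \<otimes> t)"
      using carr S_mult by (subst fraction_mem_iff) auto
    then show ?thesis using carr S_mult by (intro fraction_eqI) auto
  qed
  have "{frc (t' \<otimes> a' \<oplus> s' \<otimes> b') (s' \<otimes> t') |a' s' b' t'. (a', s') \<in> frc a s \<and> (b', t') \<in> frc b t}
      = {frc (t \<otimes> a \<oplus> s \<otimes> b) (s \<otimes> t)}"
    using eq fraction_self[OF a] fraction_self[OF b] by blast
  then show ?thesis unfolding localization_def by simp
qed

lemma add_fraction_same:
  assumes "a \<in> carrier A" "b \<in> carrier A" "s \<in> S"
  shows "frc a s \<oplus>\<^bsub>L\<^esub> frc b s = frc (a \<oplus> b) s"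
proof -
  have "frc a s \<oplus>\<^bsub>L\<^esub> frc b s = frc (s \<otimes> (a \<oplus> b)) (s \<otimes> s)"
    using assms by (simp add: add_fraction r_distr)
  then show ?thesis using assms by (simp add: fraction_scale)
qed

lemma carrier_localization: "carrier L = {frc a s |a s. a \<in> carrier A \<and> s \<in> S}"
  by (simp add: localization_def)

lemma zero_localization: "\<zero>\<^bsub>L\<^esub> = frc \<zero> \<one>" and one_localization: "\<one>\<^bsub>L\<^esub> = frc \<one> \<one>"
  by (simp_all add: localization_def)

lemma fraction_zero: "s \<in> S \<Longrightarrow> frc \<zero> s = \<zero>\<^bsub>L\<^esub>"
  unfolding zero_localization using one_in_S fraction_scale[of \<zero> \<one> s] by simp

lemma fraction_same: "s \<in> S \<Longrightarrow> frc s s = \<one>\<^bsub>L\<^esub>"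
  unfolding one_localization using one_in_S fraction_scale[of \<one> \<one> s] by simp

lemma fraction_closed: "a \<in> carrier A \<Longrightarrow> s \<in> S \<Longrightarrow> frc a s \<in> carrier L"
  unfolding carrier_localization by blast

text \<open>With a common denominator, the ring axioms of the localization become those of \<open>A\<close> applied to the
  numerators.\<close>

lemma common_denominator:
  assumes "x \<in> carrier L" "y \<in> carrier L" "z \<in> carrier L"
  obtains a b c s where "a \<in> carrier A" "b \<in> carrier A" "c \<in> carrier A" "s \<in> S"
    "x = frc a s" "y = frc b s" "z = frc c s"
proof -
  obtain a s where a: "a \<in> carrier A" "s \<in> S" "x = frc a s"
    using assms carrier_localization by auto
  obtain b t where b: "b \<in> carrier A" "t \<in> S" "y = frc b t"
    using assms carrier_localization by auto
  obtain c w where c: "c \<in> carrier A" "w \<in> S" "z = frc c w"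
    using assms carrier_localization by auto
  show thesis
  proof (rule that)
    have x: "frc (t \<otimes> w \<otimes> a) (t \<otimes> w \<otimes> s) = x"
      using a b c S_mult by (simp add: fraction_scale)
    have y: "frc (s \<otimes> w \<otimes> b) (s \<otimes> w \<otimes> t) = y"
      using a b c S_mult by (simp add: fraction_scale)
    have z: "frc (s \<otimes> t \<otimes> c) (s \<otimes> t \<otimes> w) = z"
      using a b c S_mult by (simp add: fraction_scale)
    have "t \<otimes> w \<otimes> s = s \<otimes> t \<otimes> w" "s \<otimes> w \<otimes> t = s \<otimes> t \<otimes> w"
      using a b c by (simp_all add: m_ac)
    with x y z show "x = frc (t \<otimes> w \<otimes> a) (s \<otimes> t \<otimes> w)" "y = frc (s \<otimes> w \<otimes> b) (s \<otimes> t \<otimes> w)"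
      "z = frc (s \<otimes> t \<otimes> c) (s \<otimes> t \<otimes> w)" by simp_all
  qed (use a b c S_mult in auto)
qed

lemma cring_localization: "cring L"
proof (rule cringI)
  show "abelian_group L"
  proof (rule abelian_groupI)
    fix x y assume x: "x \<in> carrier L" and y: "y \<in> carrier L"
    from common_denominator[OF x y y] obtain a b s where
      ab: "a \<in> carrier A" "b \<in> carrier A" "s \<in> S" "x = frc a s" "y = frc b s" .
    then show "x \<oplus>\<^bsub>L\<^esub> y \<in> carrier L"
      by (simp add: add_fraction_same fraction_closed)
    show "x \<oplus>\<^bsub>L\<^esub> y = y \<oplus>\<^bsub>L\<^esub> x"
      using ab by (simp add: add_fraction_same a_comm)
    have "frc a s \<oplus>\<^bsub>L\<^esub> frc (\<ominus> a) s = \<zero>\<^bsub>L\<^esub>" "frc (\<ominus> a) s \<oplus>\<^bsub>L\<^esub> frc a s = \<zero>\<^bsub>L\<^esub>"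
      using ab by (simp_all add: add_fraction_same fraction_zero r_neg l_neg)
    then show "\<exists>y\<in>carrier L. y \<oplus>\<^bsub>L\<^esub> x = \<zero>\<^bsub>L\<^esub>"
      using ab fraction_closed[of "\<ominus> a" s] by auto
    have "frc \<zero> s \<oplus>\<^bsub>L\<^esub> frc a s = frc a s" using ab by (simp add: add_fraction_same)
    then show "\<zero>\<^bsub>L\<^esub> \<oplus>\<^bsub>L\<^esub> x = x" using ab by (simp add: fraction_zero)
  next
    fix x y z assume "x \<in> carrier L" "y \<in> carrier L" "z \<in> carrier L"
    from common_denominator[OF this] obtain a b c s where
      "a \<in> carrier A" "b \<in> carrier A" "c \<in> carrier A" "s \<in> S" "x = frc a s" "y = frc b s" "z = frc c s" .
    then show "x \<oplus>\<^bsub>L\<^esub> y \<oplus>\<^bsub>L\<^esub> z = x \<oplus>\<^bsub>L\<^esub> (y \<oplus>\<^bsub>L\<^esub> z)"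
      by (simp add: add_fraction_same a_assoc)
  next
    show "\<zero>\<^bsub>L\<^esub> \<in> carrier L" unfolding zero_localization using one_in_S by (simp add: fraction_closed)
  qed
  show "comm_monoid L"
  proof (rule comm_monoidI)
    show "\<one>\<^bsub>L\<^esub> \<in> carrier L" unfolding one_localization using one_in_S by (simp add: fraction_closed)
  next
    fix x y z assume "x \<in> carrier L" "y \<in> carrier L" "z \<in> carrier L"
    from common_denominator[OF this] obtain a b c s where
      abc: "a \<in> carrier A" "b \<in> carrier A" "c \<in> carrier A" "s \<in> S" "x = frc a s" "y = frc b s" "z = frc c s" .
    then show "x \<otimes>\<^bsub>L\<^esub> y \<otimes>\<^bsub>L\<^esub> z = x \<otimes>\<^bsub>L\<^esub> (y \<otimes>\<^bsub>L\<^esub> z)"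
      by (simp add: mult_fraction S_mult m_assoc)
  next
    fix x y assume x: "x \<in> carrier L" and y: "y \<in> carrier L"
    from common_denominator[OF x y y] obtain a b s where
      ab: "a \<in> carrier A" "b \<in> carrier A" "s \<in> S" "x = frc a s" "y = frc b s" .
    then show "x \<otimes>\<^bsub>L\<^esub> y \<in> carrier L"
      by (simp add: mult_fraction S_mult fraction_closed)
    show "x \<otimes>\<^bsub>L\<^esub> y = y \<otimes>\<^bsub>L\<^esub> x"
      using ab by (simp add: mult_fraction m_comm)
    show "\<one>\<^bsub>L\<^esub> \<otimes>\<^bsub>L\<^esub> x = x"
      using ab one_in_S unfolding one_localization by (simp add: mult_fraction)
  qed
  fix x y z assume "x \<in> carrier L" "y \<in> carrier L" "z \<in> carrier L"
  from common_denominator[OF this] obtain a b c s where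
    "a \<in> carrier A" "b \<in> carrier A" "c \<in> carrier A" "s \<in> S" "x = frc a s" "y = frc b s" "z = frc c s" .
  then show "(x \<oplus>\<^bsub>L\<^esub> y) \<otimes>\<^bsub>L\<^esub> z = x \<otimes>\<^bsub>L\<^esub> z \<oplus>\<^bsub>L\<^esub> y \<otimes>\<^bsub>L\<^esub> z"
    by (simp add: add_fraction_same mult_fraction S_mult l_distr)
qed

definition extension :: "'a set \<Rightarrow> ('a \<times> 'a) set set" where
  "extension Q = {frc a s |a s. a \<in> Q \<and> s \<in> S}"

definition contraction :: "('a \<times> 'a) set set \<Rightarrow> 'a set" where
  "contraction Q = {a \<in> carrier A. frc a \<one> \<in> Q}"

text \<open>That \<open>Q\<close> is prime and avoids \<open>S\<close> makes membership of a fraction independent of how it is written: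
  the denominators can be cancelled modulo \<open>Q\<close>.\<close>

lemma fraction_in_extension_iff:
  assumes Q: "primeideal Q A" "Q \<inter> S = {}" and a: "a \<in> carrier A" "s \<in> S"
  shows "frc a s \<in> extension Q \<longleftrightarrow> a \<in> Q"
proof
  interpret Q: primeideal Q A by fact
  assume "frc a s \<in> extension Q"
  then obtain b t where b: "b \<in> Q" "t \<in> S" "frc a s = frc b t"
    unfolding extension_def by blast
  then obtain u where u: "u \<in> S" "u \<otimes> (t \<otimes> a) = u \<otimes> (s \<otimes> b)"
    using fraction_eq_iff[OF a Q.Icarr] by blast
  have "(u \<otimes> t) \<otimes> a = (u \<otimes> s) \<otimes> b"
    using u a b Q.Icarr by (simp add: m_assoc)
  also have "\<dots> \<in> Q" using u a b by (intro Q.I_l_closed) auto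
  finally have "(u \<otimes> t) \<otimes> a \<in> Q" .
  moreover have "u \<otimes> t \<notin> Q" using Q(2) u b S_mult by blast
  ultimately show "a \<in> Q" using Q.I_prime[of "u \<otimes> t" a] u b a by auto
next
  assume "a \<in> Q"
  then show "frc a s \<in> extension Q" unfolding extension_def using a by blast
qed

lemma extension_primeideal:
  assumes Q: "primeideal Q A" "Q \<inter> S = {}"
  shows "primeideal (extension Q) L"
proof -
  interpret Q: primeideal Q A by fact
  interpret L: cring L by (rule cring_localization)
  note mem = fraction_in_extension_iff[OF Q]
  have sub: "extension Q \<subseteq> carrier L"
    unfolding extension_def carrier_localization using Q.Icarr by blast
  have mult: "x \<otimes>\<^bsub>L\<^esub> y \<in> extension Q" if "x \<in> extension Q" "y \<in> carrier L" for x y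
  proof -
    from that sub have x: "x \<in> carrier L" by blast
    from common_denominator[OF x that(2) that(2)] obtain a b s where
      ab: "a \<in> carrier A" "b \<in> carrier A" "s \<in> S" "x = frc a s" "y = frc b s" .
    then have "a \<in> Q" using that mem by simp
    then have "a \<otimes> b \<in> Q" using ab by (intro Q.I_r_closed)
    then show ?thesis using ab mem[of "a \<otimes> b" "s \<otimes> s"] by (simp add: mult_fraction S_mult)
  qed
  have "ideal (extension Q) L"
  proof (rule idealI[OF L.ring_axioms])
    show "subgroup (extension Q) (add_monoid L)"
    proof (rule L.add.subgroupI)
      show "extension Q \<subseteq> carrier L" by (rule sub)
      show "extension Q \<noteq> {}" unfolding extension_def using one_in_S
        additive_subgroup.zero_closed[OF Q.additive_subgroup_axioms] by blast
      show "\<ominus>\<^bsub>L\<^esub> x \<in> extension Q" if x: "x \<in> extension Q" for x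
      proof -
        have "\<ominus>\<^bsub>L\<^esub> x = x \<otimes>\<^bsub>L\<^esub> (\<ominus>\<^bsub>L\<^esub> \<one>\<^bsub>L\<^esub>)" using sub x by (simp add: L.r_minus subset_iff)
        then show ?thesis using mult[OF x] by simp
      qed
      show "x \<oplus>\<^bsub>L\<^esub> y \<in> extension Q" if xy: "x \<in> extension Q" "y \<in> extension Q" for x y
      proof -
        have x: "x \<in> carrier L" and y: "y \<in> carrier L" using xy sub by blast+
        from common_denominator[OF x y y] obtain a b s where
          ab: "a \<in> carrier A" "b \<in> carrier A" "s \<in> S" "x = frc a s" "y = frc b s" .
        then have "a \<in> Q" "b \<in> Q" using xy mem by simp_all
        then show ?thesis using ab mem[of "a \<oplus> b" s] by (simp add: add_fraction_same)
      qed
    qed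
    fix x y assume x: "x \<in> extension Q" and y: "y \<in> carrier L"
    then show xy: "x \<otimes>\<^bsub>L\<^esub> y \<in> extension Q" by (rule mult)
    have "y \<otimes>\<^bsub>L\<^esub> x = x \<otimes>\<^bsub>L\<^esub> y" using x y sub by (intro L.m_comm) auto
    with xy show "y \<otimes>\<^bsub>L\<^esub> x \<in> extension Q" by simp
  qed
  then show ?thesis
  proof (rule primeidealI[OF _ L.cring_axioms])
    have "\<one> \<notin> Q" using Q(2) one_in_S by blast
    then have "frc \<one> \<one> \<notin> extension Q" using mem one_in_S by simp
    then show "carrier L \<noteq> extension Q" using fraction_closed[OF one_closed one_in_S] by blast
    fix x y assume x: "x \<in> carrier L" and y: "y \<in> carrier L" and xy: "x \<otimes>\<^bsub>L\<^esub> y \<in> extension Q"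
    from common_denominator[OF x y y] obtain a b s where
      ab: "a \<in> carrier A" "b \<in> carrier A" "s \<in> S" "x = frc a s" "y = frc b s" .
    then have "a \<otimes> b \<in> Q" using xy mem[of "a \<otimes> b" "s \<otimes> s"] by (simp add: mult_fraction S_mult)
    then have "a \<in> Q \<or> b \<in> Q" using ab by (intro Q.I_prime)
    then show "x \<in> extension Q \<or> y \<in> extension Q" using ab mem by simp
  qed
qed

lemma localization_hom: "ring_hom_ring A L (\<lambda>a. frc a \<one>)"
proof (rule ring_hom_ringI)
  fix a b assume a: "a \<in> carrier A" and b: "b \<in> carrier A"
  show "frc a \<one> \<in> carrier L" using a one_in_S by (rule fraction_closed)
  show "frc (a \<otimes> b) \<one> = frc a \<one> \<otimes>\<^bsub>L\<^esub> frc b \<one>" using a b one_in_S by (simp add: mult_fraction)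
  show "frc (a \<oplus> b) \<one> = frc a \<one> \<oplus>\<^bsub>L\<^esub> frc b \<one>" using a b one_in_S by (simp add: add_fraction_same)
next
  show "frc \<one> \<one> = \<one>\<^bsub>L\<^esub>" by (rule one_localization[symmetric])
qed (rule ring_axioms cring.axioms(1)[OF cring_localization])+

lemma fraction_in_prime_iff:
  assumes Q: "primeideal Q L" and a: "a \<in> carrier A" "s \<in> S"
  shows "frc a s \<in> Q \<longleftrightarrow> a \<in> contraction Q"
proof -
  interpret Q: primeideal Q L by fact
  have "frc a \<one> = frc a s \<otimes>\<^bsub>L\<^esub> frc s \<one>"
    using a one_in_S fraction_scale[of a \<one> s] by (simp add: mult_fraction m_comm)
  moreover have "frc a s = frc a \<one> \<otimes>\<^bsub>L\<^esub> frc \<one> s"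
    using a one_in_S by (simp add: mult_fraction)
  moreover have "frc s \<one> \<in> carrier L" "frc \<one> s \<in> carrier L"
    using a one_in_S by (simp_all add: fraction_closed)
  ultimately have "frc a s \<in> Q \<longleftrightarrow> frc a \<one> \<in> Q"
    using Q.I_r_closed by metis
  then show ?thesis unfolding contraction_def using a by simp
qed

lemma contraction_primeideal:
  assumes Q: "primeideal Q L"
  shows "primeideal (contraction Q) A"
proof -
  interpret Q: primeideal Q L by fact
  have one: "frc \<one> \<one> \<notin> Q"
    using prime_one_notin[OF Q] one_localization by simp
  show ?thesis
  proof (rule primeidealI[OF _ cring_axioms])
    show "ideal (contraction Q) A"
      unfolding contraction_def by (rule ring_hom_ring.ideal_vimage[OF localization_hom Q.ideal_axioms])
    have "\<one> \<notin> contraction Q" unfolding contraction_def using one by simp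
    then show "carrier A \<noteq> contraction Q" using one_closed by blast
    fix a b assume ab: "a \<in> carrier A" "b \<in> carrier A" "a \<otimes> b \<in> contraction Q"
    then have "frc a \<one> \<otimes>\<^bsub>L\<^esub> frc b \<one> \<in> Q"
      using one_in_S by (simp add: contraction_def mult_fraction)
    then have "frc a \<one> \<in> Q \<or> frc b \<one> \<in> Q"
      using ab one_in_S by (intro Q.I_prime fraction_closed)
    then show "a \<in> contraction Q \<or> b \<in> contraction Q" using ab by (simp add: contraction_def)
  qed
qed

lemma contraction_disjoint:
  assumes Q: "primeideal Q L"
  shows "contraction Q \<inter> S = {}"
proof -
  interpret Q: primeideal Q L by fact
  have "s \<notin> contraction Q" if s: "s \<in> S" for s
  proof
    assume "s \<in> contraction Q"
    then have "frc s s \<in> Q" using fraction_in_prime_iff[OF Q _ s] s by simp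
    then show False using prime_one_notin[OF Q] fraction_same[OF s] by simp
  qed
  then show ?thesis by blast
qed

text \<open>Together with \<open>extension_primeideal\<close>, \<open>contraction_primeideal\<close> and \<open>contraction_disjoint\<close> this
  describes the primes of the localization as the primes of \<open>A\<close> that avoid \<open>S\<close>.\<close>

lemma extension_contraction:
  assumes Q: "primeideal Q L"
  shows "extension (contraction Q) = Q"
proof -
  interpret Q: primeideal Q L by fact
  have "x \<in> extension (contraction Q) \<longleftrightarrow> x \<in> Q" if x: "x \<in> carrier L" for x
  proof -
    obtain a s where "a \<in> carrier A" "s \<in> S" "x = frc a s" using x carrier_localization by auto
    then show ?thesis
      using fraction_in_extension_iff[OF contraction_primeideal[OF Q] contraction_disjoint[OF Q]]
        fraction_in_prime_iff[OF Q] by simp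
  qed
  moreover have "extension (contraction Q) \<subseteq> carrier L"
    unfolding extension_def contraction_def carrier_localization by blast
  ultimately show ?thesis using Q.a_subset by blast
qed

end

section \<open>Noetherian domains of dimension one\<close>

text \<open>Otherwise \<open>0 \<subset> \<qq> \<subset> \<pp>\<close> would be a chain of length two.\<close>

lemma prime_eq_if_subset:
  assumes R: "domain R" "krull_dim R \<le> 1"
    and \<qq>: "primeideal \<qq> R" "\<qq> \<noteq> {\<zero>\<^bsub>R\<^esub>}" and \<pp>: "primeideal \<pp> R" "\<qq> \<subseteq> \<pp>"
  shows "\<qq> = \<pp>"
proof (rule ccontr)
  assume "\<qq> \<noteq> \<pp>"
  interpret domain R by fact
  interpret \<qq>: primeideal \<qq> R by fact
  let ?P = "\<lambda>i :: nat. if i = 0 then {\<zero>\<^bsub>R\<^esub>} else if i = 1 then \<qq> else \<pp>"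
  have "\<zero>\<^bsub>R\<^esub> \<in> \<qq>" by (rule additive_subgroup.zero_closed[OF \<qq>.additive_subgroup_axioms])
  then have "\<forall>i<2. ?P i \<subset> ?P (Suc i)"
    using \<qq>(2) \<pp>(2) \<open>\<qq> \<noteq> \<pp>\<close> by (auto simp: less_2_cases_iff)
  moreover have "\<forall>i\<le>2. primeideal (?P i) R" using zeroprimeideal \<qq>(1) \<pp>(1) by simp
  ultimately have "enat 2 \<le> krull_dim R"
    unfolding krull_dim_def by (intro SUP_upper CollectI exI[of _ ?P] conjI)
  then have "enat 2 \<le> 1" using R(2) by (rule order_trans)
  then show False by (simp add: one_enat_def)
qed

text \<open>The ideals without the property \<open>Q\<close> would have a maximal element, because chains of ideals contain
  their union in a noetherian ring.\<close>

lemma (in noetherian_ring) noetherian_induct [consumes 1, case_names ideal]: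
  assumes "ideal J R"
    and step: "\<And>J. ideal J R \<Longrightarrow> (\<And>K. ideal K R \<Longrightarrow> J \<subset> K \<Longrightarrow> Q K) \<Longrightarrow> Q J"
  shows "Q J"
proof (rule ccontr)
  assume "\<not> Q J"
  let ?\<A> = "{J. ideal J R \<and> \<not> Q J}"
  have "\<exists>M\<in>?\<A>. \<forall>J\<in>?\<A>. M \<subseteq> J \<longrightarrow> J = M"
  proof (rule subset_Zorn_nonempty)
    show "?\<A> \<noteq> {}" using assms(1) \<open>\<not> Q J\<close> by blast
    fix \<C> assume \<C>: "\<C> \<noteq> {}" "subset.chain ?\<A> \<C>"
    then have "subset.chain {J. ideal J R} \<C>" unfolding pred_on.chain_def by blast
    then have "\<Union>\<C> \<in> \<C>" using ideal_chain_is_trivial \<C>(1) by blast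
    then show "\<Union>\<C> \<in> ?\<A>" using \<C>(2) unfolding pred_on.chain_def by blast
  qed
  then obtain M where "M \<in> ?\<A>" and max: "\<forall>J\<in>?\<A>. M \<subseteq> J \<longrightarrow> J = M" by (elim bexE)
  then have M: "ideal M R" "\<not> Q M" by simp_all
  have "Q M"
  proof (rule step[OF M(1)])
    show "Q K" if "ideal K R" "M \<subset> K" for K
      using max that by auto
  qed
  with M(2) show False ..
qed

text \<open>Only finitely many primes contain \<open>J\<close>, and prime avoidance would give \<open>s\<close>. Noetherian induction on
  \<open>J\<close> yields \<open>s\<close> directly. A prime \<open>J\<close> is contained in no prime but itself, because the dimension is one; so \<open>1\<close>
  serves if \<open>J = \<pp>\<close>, and any element of \<open>J\<close> outside \<open>\<pp>\<close> otherwise. If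
  \<open>J\<close> is proper and not prime, take \<open>a b \<in> J\<close> with \<open>a, b \<notin> J\<close>; every prime containing \<open>J\<close> contains \<open>J + (a)\<close>
  or \<open>J + (b)\<close>, so the product of the elements belonging to these two larger ideals works.\<close>

lemma (in noetherian_domain) separating_element:
  assumes dim: "krull_dim R \<le> 1" and \<pp>: "primeideal \<pp> R"
    and J: "ideal J R" "J \<noteq> {\<zero>}"
  shows "\<exists>s\<in>carrier R - \<pp>. \<forall>\<qq>. primeideal \<qq> R \<longrightarrow> J \<subseteq> \<qq> \<longrightarrow> \<qq> \<noteq> \<pp> \<longrightarrow> s \<in> \<qq>"
proof -
  interpret \<pp>: primeideal \<pp> R by fact
  have "cring R" by (rule domain.axioms(1)[OF domain_axioms])
  interpret cring R by fact
  show ?thesis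
    using J
  proof (induction J rule: noetherian_induct)
    case (ideal J)
    interpret J: ideal J R by fact
    consider "J = carrier R" | "primeideal J R" "J \<noteq> \<pp>" | "J = \<pp>" | "J \<noteq> carrier R" "\<not> primeideal J R"
      by blast
    then show ?case
    proof cases
      case 1
      then have "\<not> J \<subseteq> \<qq>" if "primeideal \<qq> R" for \<qq>
        using primeideal.I_notcarr[OF that] ideal.Icarr[OF primeideal.axioms(1)[OF that]] by blast
      moreover have "\<one> \<in> carrier R - \<pp>" using prime_one_notin[OF \<pp>] by simp
      ultimately show ?thesis by blast
    next
      case 2
      then have "\<not> J \<subseteq> \<pp>"
        using prime_eq_if_subset[OF domain_axioms dim 2(1) ideal.prems \<pp>] by blast
      then obtain s where "s \<in> J" "s \<notin> \<pp>" by blast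
      then show ?thesis using J.Icarr by blast
    next
      case 3
      then have "\<qq> = \<pp>" if "primeideal \<qq> R" "J \<subseteq> \<qq>" for \<qq>
        using prime_eq_if_subset[OF domain_axioms dim \<pp> _ that(1)] that ideal.prems by blast
      moreover have "\<one> \<in> carrier R - \<pp>" using prime_one_notin[OF \<pp>] by simp
      ultimately show ?thesis by blast
    next
      case 4
      then obtain a b where ab: "a \<in> carrier R" "b \<in> carrier R" "a \<otimes> b \<in> J" "a \<notin> J" "b \<notin> J"
        using primeidealI[OF J.ideal_axioms \<open>cring R\<close>] by blast
      have enlarge: "\<exists>s\<in>carrier R - \<pp>. \<forall>\<qq>. primeideal \<qq> R \<longrightarrow> J \<subseteq> \<qq> \<longrightarrow> x \<in> \<qq> \<longrightarrow> \<qq> \<noteq> \<pp> \<longrightarrow> s \<in> \<qq>"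
        if x: "x \<in> carrier R" "x \<notin> J" for x
      proof -
        let ?K = "Idl (insert x J)"
        have ins: "insert x J \<subseteq> carrier R" using x J.a_subset by blast
        have K: "ideal ?K R" using ins by (rule genideal_ideal)
        have sub: "insert x J \<subseteq> ?K" using ins by (rule genideal_self)
        then have "J \<subset> ?K" using x by blast
        have "\<zero> \<in> J" by (rule additive_subgroup.zero_closed[OF J.additive_subgroup_axioms])
        with \<open>J \<subset> ?K\<close> have "?K \<noteq> {\<zero>}" by auto
        from ideal.IH[OF K \<open>J \<subset> ?K\<close> this] obtain s where s: "s \<in> carrier R - \<pp>"
          "\<forall>\<qq>. primeideal \<qq> R \<longrightarrow> ?K \<subseteq> \<qq> \<longrightarrow> \<qq> \<noteq> \<pp> \<longrightarrow> s \<in> \<qq>"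
          by (elim bexE)
        have "?K \<subseteq> \<qq>" if "primeideal \<qq> R" "J \<subseteq> \<qq>" "x \<in> \<qq>" for \<qq>
          using that primeideal.axioms(1) by (intro genideal_minimal) auto
        with s(2) show ?thesis by (intro bexI[OF _ s(1)]) blast
      qed
      obtain s where s: "s \<in> carrier R - \<pp>"
        "\<forall>\<qq>. primeideal \<qq> R \<longrightarrow> J \<subseteq> \<qq> \<longrightarrow> a \<in> \<qq> \<longrightarrow> \<qq> \<noteq> \<pp> \<longrightarrow> s \<in> \<qq>"
        using enlarge[OF ab(1,4)] by (elim bexE)
      obtain t where t: "t \<in> carrier R - \<pp>"
        "\<forall>\<qq>. primeideal \<qq> R \<longrightarrow> J \<subseteq> \<qq> \<longrightarrow> b \<in> \<qq> \<longrightarrow> \<qq> \<noteq> \<pp> \<longrightarrow> t \<in> \<qq>"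
        using enlarge[OF ab(2,5)] by (elim bexE)
      show ?thesis
      proof
        show "s \<otimes> t \<in> carrier R - \<pp>" using s(1) t(1) \<pp>.I_prime by blast
        show "\<forall>\<qq>. primeideal \<qq> R \<longrightarrow> J \<subseteq> \<qq> \<longrightarrow> \<qq> \<noteq> \<pp> \<longrightarrow> s \<otimes> t \<in> \<qq>"
        proof (intro allI impI)
          fix \<qq> assume \<qq>: "primeideal \<qq> R" "J \<subseteq> \<qq>" "\<qq> \<noteq> \<pp>"
          interpret \<qq>: primeideal \<qq> R by fact
          have "a \<in> \<qq> \<or> b \<in> \<qq>" using \<qq>.I_prime ab \<qq> by blast
          then have "s \<in> \<qq> \<or> t \<in> \<qq>" using s(2) t(2) \<qq> by blast
          then show "s \<otimes> t \<in> \<qq>" using s(1) t(1) \<qq>.I_l_closed \<qq>.I_r_closed by blast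
        qed
      qed
    qed
  qed
qed

section \<open>Algebras whose torsion is prime\<close>

definition torsion_elements ::
    "('r, 'b) ring_scheme \<Rightarrow> ('r \<Rightarrow> 'a) \<Rightarrow> ('a, 'c) ring_scheme \<Rightarrow> 'a set" where
  "torsion_elements R \<phi> A =
    {a \<in> carrier A. \<exists>r\<in>carrier R. r \<noteq> \<zero>\<^bsub>R\<^esub> \<and> \<phi> r \<otimes>\<^bsub>A\<^esub> a = \<zero>\<^bsub>A\<^esub>}"

text \<open>The shape of the spectrum that is common to all forcing algebras over a one-dimensional base. The
  set of elements \<open>r\<close> with \<open>\<phi> r \<in> Q\<close> is the prime of \<open>R\<close> below \<open>Q\<close>. The last assumption
  says that if this fibre contains a point outside the closure of the generic fibre, then the primes
  containing the image of the prime below \<open>Q\<close> form an irreducible closed set, with generic point \<open>Q0\<close>.\<close>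

locale one_dimensional_base =
  R: noetherian_domain R + \<phi>: ring_hom_cring R A \<phi>
  for R :: "('r, 'b) ring_scheme" and A :: "('a, 'c) ring_scheme" and \<phi> +
  assumes dim: "krull_dim R \<le> 1"
    and T_prime: "primeideal (torsion_elements R \<phi> A) A"
    and fibre: "\<And>Q. primeideal Q A \<Longrightarrow> \<not> torsion_elements R \<phi> A \<subseteq> Q \<Longrightarrow>
      \<exists>Q0. primeideal Q0 A \<and> \<phi> ` {r \<in> carrier R. \<phi> r \<in> Q} \<subseteq> Q0 \<and>
        (\<forall>Q'. primeideal Q' A \<longrightarrow> \<phi> ` {r \<in> carrier R. \<phi> r \<in> Q} \<subseteq> Q' \<longrightarrow> Q0 \<subseteq> Q')"
begin

abbreviation "T \<equiv> torsion_elements R \<phi> A"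

abbreviation base :: "'a set \<Rightarrow> 'r set" where
  "base Q \<equiv> {r \<in> carrier R. \<phi> r \<in> Q}"

lemma base_primeideal: "primeideal Q A \<Longrightarrow> primeideal (base Q) R"
  by (rule \<phi>.primeideal_vimage)

text \<open>If \<open>\<phi> r\<close> with \<open>r \<noteq> 0\<close> were killed by \<open>s \<noteq> 0\<close>, then \<open>s r \<noteq> 0\<close> would kill \<open>1\<close>, but \<open>T\<close> is
  proper. Hence \<open>T\<close> survives in the localization at every prime of \<open>R\<close>.\<close>

lemma base_T: "base T = {\<zero>\<^bsub>R\<^esub>}"
proof
  interpret T: primeideal T A by (rule T_prime)
  have "r = \<zero>\<^bsub>R\<^esub>" if r: "r \<in> carrier R" "\<phi> r \<in> T" for r
  proof (rule ccontr)
    assume "r \<noteq> \<zero>\<^bsub>R\<^esub>"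
    from r(2) obtain s where s: "s \<in> carrier R" "s \<noteq> \<zero>\<^bsub>R\<^esub>" "\<phi> s \<otimes>\<^bsub>A\<^esub> \<phi> r = \<zero>\<^bsub>A\<^esub>"
      unfolding torsion_elements_def by blast
    have "s \<otimes>\<^bsub>R\<^esub> r \<noteq> \<zero>\<^bsub>R\<^esub>" using s r \<open>r \<noteq> \<zero>\<^bsub>R\<^esub>\<close> R.integral_iff by simp
    moreover have "\<phi> (s \<otimes>\<^bsub>R\<^esub> r) \<otimes>\<^bsub>A\<^esub> \<one>\<^bsub>A\<^esub> = \<zero>\<^bsub>A\<^esub>" using s r by simp
    ultimately have "\<one>\<^bsub>A\<^esub> \<in> T" unfolding torsion_elements_def using s r by blast
    then show False using prime_one_notin[OF T_prime] by simp
  qed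
  then show "base T \<subseteq> {\<zero>\<^bsub>R\<^esub>}" by blast
  show "{\<zero>\<^bsub>R\<^esub>} \<subseteq> base T"
    using additive_subgroup.zero_closed[OF T.additive_subgroup_axioms] by simp
qed

lemma T_subset_if_base_zero:
  assumes Q: "primeideal Q A" and "base Q = {\<zero>\<^bsub>R\<^esub>}"
  shows "T \<subseteq> Q"
proof
  interpret Q: primeideal Q A by fact
  fix a assume "a \<in> T"
  then obtain r where r: "a \<in> carrier A" "r \<in> carrier R" "r \<noteq> \<zero>\<^bsub>R\<^esub>" "\<phi> r \<otimes>\<^bsub>A\<^esub> a = \<zero>\<^bsub>A\<^esub>"
    unfolding torsion_elements_def by blast
  have "\<phi> r \<otimes>\<^bsub>A\<^esub> a \<in> Q"
    unfolding r(4) by (rule additive_subgroup.zero_closed[OF Q.additive_subgroup_axioms])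
  then have "\<phi> r \<in> Q \<or> a \<in> Q" using r by (intro Q.I_prime) auto
  moreover have "\<phi> r \<notin> Q" using assms(2) r by blast
  ultimately show "a \<in> Q" by blast
qed

lemma complement_system:
  assumes \<pp>: "primeideal \<pp> R"
  shows "multiplicative_system A (\<phi> ` (carrier R - \<pp>))"
proof -
  interpret \<pp>: primeideal \<pp> R by fact
  show ?thesis
  proof (intro multiplicative_system.intro multiplicative_system_axioms.intro \<phi>.S.cring_axioms)
    show "\<phi> ` (carrier R - \<pp>) \<subseteq> carrier A" by auto
    have "\<phi> \<one>\<^bsub>R\<^esub> \<in> \<phi> ` (carrier R - \<pp>)" using prime_one_notin[OF \<pp>] by (intro imageI) simp
    then show "\<one>\<^bsub>A\<^esub> \<in> \<phi> ` (carrier R - \<pp>)" by simp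
    fix s t assume "s \<in> \<phi> ` (carrier R - \<pp>)" "t \<in> \<phi> ` (carrier R - \<pp>)"
    then obtain a b where ab: "a \<in> carrier R" "a \<notin> \<pp>" "s = \<phi> a" "b \<in> carrier R" "b \<notin> \<pp>" "t = \<phi> b"
      by blast
    have "a \<otimes>\<^bsub>R\<^esub> b \<notin> \<pp>" using ab \<pp>.I_prime by blast
    then have "\<phi> (a \<otimes>\<^bsub>R\<^esub> b) \<in> \<phi> ` (carrier R - \<pp>)" using ab by (intro imageI) simp
    then show "s \<otimes>\<^bsub>A\<^esub> t \<in> \<phi> ` (carrier R - \<pp>)" using ab by simp
  qed
qed

lemma disjoint_complement_iff:
  "Q \<inter> \<phi> ` (carrier R - \<pp>) = {} \<longleftrightarrow> base Q \<subseteq> \<pp>"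
  by blast

text \<open>The decomposition of \<open>Spec A\<close> is pulled back to the localization at the prime below some \<open>Q\<close> in
  \<open>V(E2)\<close>. Both parts stay nonempty, because \<open>T\<close> and \<open>Q\<close> both survive there.\<close>

lemma disconnected_localization:
  assumes D: "disconnects A E1 E2" and T: "E1 \<subseteq> T"
  shows "\<exists>\<pp>. primeideal \<pp> R \<and> \<not> connected_spec (localization A (\<phi> ` (carrier R - \<pp>)))"
proof -
  obtain Q where Q: "primeideal Q A" "E2 \<subseteq> Q" using disconnectsD(5)[OF D] by blast
  have \<pp>: "primeideal (base Q) R" using Q(1) by (rule base_primeideal)
  define S where "S = \<phi> ` (carrier R - base Q)"
  interpret multiplicative_system A S unfolding S_def using \<pp> by (rule complement_system)
  have TS: "T \<inter> S = {}"
    unfolding S_def disjoint_complement_iff base_T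
    using additive_subgroup.zero_closed[OF ideal.axioms(1)[OF primeideal.axioms(1)[OF \<pp>]]] by blast
  have QS: "Q \<inter> S = {}" unfolding S_def disjoint_complement_iff ..
  let ?E = "\<lambda>E. (\<lambda>e. frc e \<one>\<^bsub>A\<^esub>) ` E"
  have closed: "?E E \<subseteq> carrier L" if "E \<subseteq> carrier A" for E
    using that one_in_S fraction_closed by blast
  have ext: "?E E \<subseteq> extension K" if "E \<subseteq> K" for E K
    using that one_in_S unfolding extension_def by blast
  have contr: "?E E \<subseteq> K \<longleftrightarrow> E \<subseteq> contraction K" if "E \<subseteq> carrier A" for E K
    using that unfolding contraction_def by blast
  note E = disconnectsD(1,2)[OF D]
  have "disconnects L (?E E1) (?E E2)"
    unfolding disconnects_def
  proof (intro conjI allI impI)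
    show "?E E1 \<subseteq> carrier L" "?E E2 \<subseteq> carrier L" using E by (simp_all only: closed)
    show "?E E1 \<subseteq> K \<longleftrightarrow> \<not> ?E E2 \<subseteq> K" if "primeideal K L" for K
      unfolding contr[OF E(1)] contr[OF E(2)]
      using disconnectsD(3)[OF D contraction_primeideal[OF that]] .
    show "\<exists>K. primeideal K L \<and> ?E E1 \<subseteq> K"
      using extension_primeideal[OF T_prime TS] ext[OF T] by blast
    show "\<exists>K. primeideal K L \<and> ?E E2 \<subseteq> K"
      using extension_primeideal[OF Q(1) QS] ext[OF Q(2)] by blast
  qed
  then have "\<not> connected_spec L"
    unfolding connected_spec_iff[OF cring.axioms(1)[OF cring_localization]] by blast
  then show ?thesis using \<pp> unfolding S_def by blast
qed

lemma locally_connected_imp_connected: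
  assumes "locally_connected_over R \<phi> A"
  shows "connected_spec A"
proof -
  have "\<not> disconnects A E1 E2" for E1 E2
  proof
    assume D: "disconnects A E1 E2"
    have "E1 \<subseteq> T \<or> E2 \<subseteq> T" using disconnectsD(3)[OF D T_prime] by blast
    then have "\<exists>\<pp>. primeideal \<pp> R \<and> \<not> connected_spec (localization A (\<phi> ` (carrier R - \<pp>)))"
      using disconnected_localization[OF D] disconnected_localization[OF disconnects_sym[OF D]]
      by (elim disjE)
    then show False using assms unfolding locally_connected_over_def by blast
  qed
  then show ?thesis
    unfolding connected_spec_iff[OF \<phi>.S.ring_axioms] using T_prime by blast
qed

text \<open>The part of \<open>Spec A\<^sub>\<pp>\<close> that does not contain \<open>T\<close> can only be the fibre over \<open>\<pp>\<close>. The element \<open>s y\<close>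
  constructed below cuts this fibre out as an open subset of \<open>Spec A\<close>, and \<open>Q0\<close> as a closed one.\<close>

lemma disconnected_global:
  assumes \<pp>: "primeideal \<pp> R"
    and D: "disconnects (localization A (\<phi> ` (carrier R - \<pp>))) E1 E2"
    and T: "E1 \<subseteq> multiplicative_system.extension A (\<phi> ` (carrier R - \<pp>)) T"
  shows "\<not> connected_spec A"
proof -
  define S where "S = \<phi> ` (carrier R - \<pp>)"
  interpret multiplicative_system A S unfolding S_def using \<pp> by (rule complement_system)
  interpret \<pp>: primeideal \<pp> R by fact
  interpret T: primeideal T A by (rule T_prime)
  note D = D[folded S_def] and T = T[folded S_def]
  have disjoint: "Q \<inter> S = {} \<longleftrightarrow> base Q \<subseteq> \<pp>" for Q
    unfolding S_def by (rule disjoint_complement_iff)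
  have TS: "T \<inter> S = {}"
    unfolding disjoint base_T
    using additive_subgroup.zero_closed[OF \<pp>.additive_subgroup_axioms] by blast
  have mono: "extension K \<subseteq> extension K'" if "K \<subseteq> K'" for K K'
    using that unfolding extension_def by blast
  \<comment> \<open>A part of a decomposition is closed and open, hence stable under specialization and
    generization.\<close>
  have comparable: "E1 \<subseteq> extension K \<longleftrightarrow> E1 \<subseteq> extension K'"
    if K: "primeideal K A" "K \<inter> S = {}" and K': "primeideal K' A" "K' \<inter> S = {}" and "K \<subseteq> K'" for K K'
  proof -
    have "E1 \<subseteq> extension K \<longleftrightarrow> \<not> E2 \<subseteq> extension K" "E1 \<subseteq> extension K' \<longleftrightarrow> \<not> E2 \<subseteq> extension K'"
      using disconnectsD(3)[OF D] extension_primeideal[OF K] extension_primeideal[OF K'] by simp_all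
    moreover have "extension K \<subseteq> extension K'" using \<open>K \<subseteq> K'\<close> by (rule mono)
    ultimately show ?thesis by (meson subset_trans)
  qed
  obtain K where K: "primeideal K L" "E2 \<subseteq> K" using disconnectsD(5)[OF D] by blast
  define Q where "Q = contraction K"
  have Q: "primeideal Q A" "Q \<inter> S = {}"
    unfolding Q_def using K(1) by (rule contraction_primeideal, rule contraction_disjoint)
  have QE: "\<not> E1 \<subseteq> extension Q"
    using disconnectsD(3)[OF D K(1)] K(2) extension_contraction[OF K(1)] unfolding Q_def by simp
  then have "\<not> T \<subseteq> Q" using comparable[OF T_prime TS Q] T by blast
  from fibre[OF Q(1) this] obtain Q0 where Q0: "primeideal Q0 A" "\<phi> ` base Q \<subseteq> Q0"
    and "\<forall>Q'. primeideal Q' A \<longrightarrow> \<phi> ` base Q \<subseteq> Q' \<longrightarrow> Q0 \<subseteq> Q'"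
    by (elim exE conjE)
  then have least: "\<And>Q'. primeideal Q' A \<Longrightarrow> \<phi> ` base Q \<subseteq> Q' \<Longrightarrow> Q0 \<subseteq> Q'" by simp
  have "base Q \<noteq> {\<zero>\<^bsub>R\<^esub>}" using T_subset_if_base_zero[OF Q(1)] \<open>\<not> T \<subseteq> Q\<close> by blast
  moreover have "base Q \<subseteq> \<pp>" using Q(2) disjoint by blast
  ultimately have base_Q: "base Q = \<pp>"
    using prime_eq_if_subset[OF R.domain_axioms dim base_primeideal[OF Q(1)] _ \<pp>] by blast
  have p_nonzero: "\<pp> \<noteq> {\<zero>\<^bsub>R\<^esub>}" using \<open>base Q \<noteq> {\<zero>\<^bsub>R\<^esub>}\<close> base_Q by simp
  have base_p: "base Q' = \<pp>" if "primeideal Q' A" "\<phi> ` \<pp> \<subseteq> Q'" for Q'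
  proof -
    have "\<pp> \<subseteq> base Q'" using that(2) \<pp>.Icarr by blast
    from prime_eq_if_subset[OF R.domain_axioms dim \<pp> p_nonzero base_primeideal[OF that(1)] this]
    show ?thesis ..
  qed
  have Q0Q: "Q0 \<subseteq> Q" using least[OF Q(1)] by blast
  have "base Q0 = \<pp>" using base_p[OF Q0(1)] Q0(2) unfolding base_Q .
  then have Q0S: "Q0 \<inter> S = {}" using disjoint by blast
  \<comment> \<open>A common point of the two pieces would lie over \<open>\<pp>\<close>, hence in \<open>Spec A\<^sub>\<pp>\<close>, and would put \<open>T\<close> and
    \<open>Q\<close> into the same part.\<close>
  have no_common: "\<not> (T \<subseteq> Q' \<and> Q0 \<subseteq> Q')" if Q': "primeideal Q' A" for Q'
  proof
    assume sub: "T \<subseteq> Q' \<and> Q0 \<subseteq> Q'"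
    then have "\<phi> ` \<pp> \<subseteq> Q'" using Q0(2) unfolding base_Q by (meson subset_trans)
    then have "base Q' = \<pp>" by (rule base_p[OF Q'])
    then have Q'S: "Q' \<inter> S = {}" using disjoint[of Q'] by simp
    have "E1 \<subseteq> extension Q'"
      using comparable[OF T_prime TS Q' Q'S conjunct1[OF sub]] T by simp
    then have "E1 \<subseteq> extension Q0"
      using comparable[OF Q0(1) Q0S Q' Q'S conjunct2[OF sub]] by simp
    then have "E1 \<subseteq> extension Q"
      using comparable[OF Q0(1) Q0S Q Q0Q] by simp
    with QE show False ..
  qed
  interpret Q0: primeideal Q0 A by fact
  have "\<exists>y\<in>T. \<exists>x\<in>Q0. \<one>\<^bsub>A\<^esub> = y \<oplus>\<^bsub>A\<^esub> x"
    using no_common by (intro \<phi>.S.comaximal_if_no_common_prime[OF T.ideal_axioms Q0.ideal_axioms]) simp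
  then obtain y x where y: "y \<in> T" and x: "x \<in> Q0" and xy: "\<one>\<^bsub>A\<^esub> = y \<oplus>\<^bsub>A\<^esub> x"
    by (elim bexE)
  obtain r where r: "y \<in> carrier A" "r \<in> carrier R" "r \<noteq> \<zero>\<^bsub>R\<^esub>" "\<phi> r \<otimes>\<^bsub>A\<^esub> y = \<zero>\<^bsub>A\<^esub>"
    using y unfolding torsion_elements_def by blast
  have rI: "r \<in> PIdl\<^bsub>R\<^esub> r" using r(2) by (rule R.cgenideal_self)
  then have "PIdl\<^bsub>R\<^esub> r \<noteq> {\<zero>\<^bsub>R\<^esub>}" using r(3) by blast
  from R.separating_element[OF dim \<pp> R.cgenideal_ideal[OF r(2)] this]
  obtain s where "s \<in> carrier R - \<pp>"
    and sep: "\<forall>\<qq>. primeideal \<qq> R \<longrightarrow> PIdl\<^bsub>R\<^esub> r \<subseteq> \<qq> \<longrightarrow> \<qq> \<noteq> \<pp> \<longrightarrow> s \<in> \<qq>"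
    by (elim bexE)
  then have s: "s \<in> carrier R" "s \<notin> \<pp>" by simp_all
  let ?e = "\<phi> s \<otimes>\<^bsub>A\<^esub> y"
  have e: "?e \<in> carrier A" using s r by simp
  have "disconnects A {?e} Q0"
    unfolding disconnects_def
  proof (intro conjI allI impI)
    show "{?e} \<subseteq> carrier A" using e by simp
    show "Q0 \<subseteq> carrier A" by (rule Q0.a_subset)
    show "\<exists>Q'. primeideal Q' A \<and> {?e} \<subseteq> Q'"
      using T_prime T.I_l_closed[OF y \<phi>.hom_closed[OF s(1)]] by (intro exI[of _ T]) simp
    show "\<exists>Q'. primeideal Q' A \<and> Q0 \<subseteq> Q'" using Q0(1) by blast
    fix Q' assume Q': "primeideal Q' A"
    interpret Q': primeideal Q' A by fact
    show "{?e} \<subseteq> Q' \<longleftrightarrow> \<not> Q0 \<subseteq> Q'"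
    proof
      \<comment> \<open>Over \<open>\<pp>\<close> the element \<open>s\<close> is a unit, and \<open>y\<close> is congruent to \<open>1\<close> modulo \<open>Q0\<close>.\<close>
      assume eQ': "{?e} \<subseteq> Q'"
      show "\<not> Q0 \<subseteq> Q'"
      proof
        assume "Q0 \<subseteq> Q'"
        then have "\<phi> ` \<pp> \<subseteq> Q'" using Q0(2) unfolding base_Q by (meson subset_trans)
        then have "base Q' = \<pp>" by (rule base_p[OF Q'])
        then have "\<phi> s \<notin> Q'" using s by blast
        then have "y \<in> Q'" using Q'.I_prime[of "\<phi> s" y] eQ' s r by simp
        moreover have "x \<in> Q'" using x \<open>Q0 \<subseteq> Q'\<close> by blast
        ultimately have "\<one>\<^bsub>A\<^esub> \<in> Q'" unfolding xy by (rule Q'.a_closed)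
        then show False using prime_one_notin[OF Q'] by simp
      qed
    next
      assume "\<not> Q0 \<subseteq> Q'"
      then have "\<not> \<phi> ` base Q \<subseteq> Q'" using least[OF Q'] by (rule contrapos_nn)
      then have "base Q' \<noteq> \<pp>" unfolding base_Q by blast
      show "{?e} \<subseteq> Q'"
      proof (rule ccontr)
        assume "\<not> {?e} \<subseteq> Q'"
        then have "?e \<notin> Q'" by simp
        then have "\<phi> s \<notin> Q'" "y \<notin> Q'"
          using Q'.I_l_closed[of y "\<phi> s"] Q'.I_r_closed[of "\<phi> s" y] \<phi>.hom_closed[OF s(1)] r(1) by metis+
        \<comment> \<open>Where \<open>y\<close> does not vanish, \<open>r\<close> does; away from \<open>\<pp>\<close> the element \<open>s\<close> then vanishes, too.\<close>
        have "\<phi> r \<otimes>\<^bsub>A\<^esub> y \<in> Q'"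
          unfolding r(4) by (rule additive_subgroup.zero_closed[OF Q'.additive_subgroup_axioms])
        then have "\<phi> r \<in> Q'" using Q'.I_prime[of "\<phi> r" y] \<open>y \<notin> Q'\<close> r by simp
        interpret B: primeideal "base Q'" R using Q' by (rule base_primeideal)
        from r(2) \<open>\<phi> r \<in> Q'\<close> have "r \<in> base Q'" by (intro CollectI conjI)
        then have "PIdl\<^bsub>R\<^esub> r \<subseteq> base Q'" by (rule R.cgenideal_minimal[OF B.ideal_axioms])
        then have "s \<in> base Q'" using B.primeideal \<open>base Q' \<noteq> \<pp>\<close> by (intro sep[rule_format])
        then have "\<phi> s \<in> Q'" unfolding mem_Collect_eq by (rule conjunct2)
        with \<open>\<phi> s \<notin> Q'\<close> show False ..
      qed
    qed
  qed
  then have "\<exists>E1 E2. disconnects A E1 E2" by (intro exI)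
  then show ?thesis unfolding connected_spec_iff[OF \<phi>.S.ring_axioms] by simp
qed

lemma connected_imp_locally_connected:
  assumes "connected_spec A"
  shows "locally_connected_over R \<phi> A"
  unfolding locally_connected_over_def
proof (intro allI impI)
  fix \<pp> assume \<pp>: "primeideal \<pp> R"
  define S where "S = \<phi> ` (carrier R - \<pp>)"
  interpret multiplicative_system A S unfolding S_def using \<pp> by (rule complement_system)
  have TS: "T \<inter> S = {}"
    unfolding S_def disjoint_complement_iff base_T
    using additive_subgroup.zero_closed[OF ideal.axioms(1)[OF primeideal.axioms(1)[OF \<pp>]]] by blast
  have T': "primeideal (extension T) L" by (rule extension_primeideal[OF T_prime TS])
  have "\<not> disconnects L E1 E2" for E1 E2
  proof
    assume D: "disconnects L E1 E2"
    have *: "\<not> E \<subseteq> extension T" if "disconnects L E E'" for E E'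
      using disconnected_global[OF \<pp> that[unfolded S_def]] assms unfolding S_def by blast
    show False
      using disconnectsD(3)[OF D T'] *[OF D] *[OF disconnects_sym[OF D]] by blast
  qed
  then show "connected_spec (localization A (\<phi> ` (carrier R - \<pp>)))"
    unfolding S_def[symmetric] connected_spec_iff[OF cring.axioms(1)[OF cring_localization]]
    using T' by blast
qed

theorem connected_iff_locally_connected:
  "connected_spec A \<longleftrightarrow> locally_connected_over R \<phi> A"
  using connected_imp_locally_connected locally_connected_imp_connected by blast

end

section \<open>Polynomial rings\<close>

lemma finite_multiset_splittings: "finite {(k, l). k + l = (m :: 'c multiset)}"
proof (rule finite_subset)
  let ?D = "\<Union>n\<le>size m. multisets_of_size (set_mset m) n"
  show "{(k, l). k + l = m} \<subseteq> ?D \<times> ?D"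
    by (auto simp: multisets_of_size_def)
  show "finite (?D \<times> ?D)"
    by (intro finite_cartesian_product finite_UN_I finite_multisets_of_size) auto
qed

context ring
begin

lemma monomial_in_indexed_pset:
  fixes I :: "'c set"
  assumes K: "additive_subgroup K R" and "c \<in> K" "set_mset m \<subseteq> I"
  shows "(\<lambda>k. if k = m then c else \<zero>) \<in> (K [\<X>\<^bsub>I\<^esub>])"
  using assms(3)
proof (induction m)
  case empty
  have "(\<lambda>k :: 'c multiset. if k = {#} then c else \<zero>) = indexed_const c" unfolding indexed_const_def ..
  then show ?case using indexed_pset.indexed_const[OF assms(2), of I] by simp
next
  case (add i m)
  have "(\<lambda>k. if k = add_mset i m then c else \<zero>) = indexed_pmult (\<lambda>k. if k = m then c else \<zero>) i"
    unfolding indexed_pmult_def by (auto simp: fun_eq_iff)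
  moreover have "indexed_pmult (\<lambda>k. if k = m then c else \<zero>) i \<in> (K [\<X>\<^bsub>I\<^esub>])"
    using add by (intro indexed_pset.indexed_pmult) auto
  ultimately show ?case by simp
qed

text \<open>The inductive description is suited to induction over polynomials, the explicit one to
  computations with coefficients. The coefficient set \<open>K\<close> will be \<open>R\<close> itself or an ideal.\<close>

lemma indexed_pset_iff:
  assumes K: "additive_subgroup K R"
  shows "p \<in> (K [\<X>\<^bsub>I\<^esub>]) \<longleftrightarrow>
    (\<forall>m. p m \<in> K) \<and> finite {m. p m \<noteq> \<zero>} \<and> (\<forall>m. p m \<noteq> \<zero> \<longrightarrow> set_mset m \<subseteq> I)"
    (is "_ \<longleftrightarrow> ?poly p")
proof
  interpret K: additive_subgroup K R by fact
  assume "p \<in> (K [\<X>\<^bsub>I\<^esub>])"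
  then show "?poly p"
  proof induction
    case (indexed_const k)
    then show ?case by (auto simp: indexed_const_def intro: finite_subset[of _ "{{#}}"])
  next
    case (indexed_padd p q)
    have "finite {m. (p \<Oplus> q) m \<noteq> \<zero>}"
      by (rule finite_subset[of _ "{m. p m \<noteq> \<zero>} \<union> {m. q m \<noteq> \<zero>}"])
        (use indexed_padd in \<open>auto simp: indexed_padd_def\<close>)
    moreover have "set_mset m \<subseteq> I" if "(p \<Oplus> q) m \<noteq> \<zero>" for m
    proof (cases "p m = \<zero>")
      case True
      then have "q m \<noteq> \<zero>" using that by (auto simp: indexed_padd_def)
      then show ?thesis using indexed_padd by blast
    qed (use indexed_padd in blast)
    ultimately show ?case using indexed_padd by (auto simp: indexed_padd_def)
  next
    case (indexed_pmult p i)
    have "finite {m. (p \<Otimes> i) m \<noteq> \<zero>}"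
      by (rule finite_subset[of _ "add_mset i ` {m. p m \<noteq> \<zero>}"])
        (use indexed_pmult in \<open>auto simp: indexed_pmult_def image_iff split: if_splits
           intro!: exI[of _ "_ - {#i#}"]\<close>)
    moreover have "set_mset m \<subseteq> I" if "(p \<Otimes> i) m \<noteq> \<zero>" for m
    proof -
      from that have "i \<in># m" "p (m - {#i#}) \<noteq> \<zero>"
        by (auto simp: indexed_pmult_def split: if_splits)
      then have "set_mset (m - {#i#}) \<subseteq> I" using indexed_pmult by blast
      moreover have "set_mset m = insert i (set_mset (m - {#i#}))"
        using \<open>i \<in># m\<close> by (metis insert_DiffM set_mset_add_mset_insert)
      ultimately show ?thesis using indexed_pmult by simp
    qed
    ultimately show ?case using indexed_pmult by (auto simp: indexed_pmult_def)
  qed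
next
  interpret K: additive_subgroup K R by fact
  have "p \<in> (K [\<X>\<^bsub>I\<^esub>])" if "finite M" "?poly p" "{m. p m \<noteq> \<zero>} = M" for M p
    using that
  proof (induction M arbitrary: p rule: finite_induct)
    case empty
    then have "p = indexed_const \<zero>" by (auto simp: indexed_const_def)
    then show ?case using indexed_pset.indexed_const[of \<zero> K I] by auto
  next
    case (insert m M)
    define q where "q = p(m := \<zero>)"
    have "q \<in> (K [\<X>\<^bsub>I\<^esub>])"
    proof (rule insert.IH)
      have *: "{m. q m \<noteq> \<zero>} = {k. p k \<noteq> \<zero>} - {m}" unfolding q_def by auto
      then show "{m. q m \<noteq> \<zero>} = M" using insert by auto
      show "?poly q" using insert.prems * by (auto simp: q_def)
    qed
    moreover have "(\<lambda>k. if k = m then p m else \<zero>) \<in> (K [\<X>\<^bsub>I\<^esub>])"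
    proof (rule monomial_in_indexed_pset[OF K])
      show "p m \<in> K" using insert.prems by blast
      have "p m \<noteq> \<zero>" using insert.prems by blast
      then show "set_mset m \<subseteq> I" using insert.prems by blast
    qed
    ultimately have "q \<Oplus> (\<lambda>k. if k = m then p m else \<zero>) \<in> (K [\<X>\<^bsub>I\<^esub>])"
      by (rule indexed_pset.indexed_padd)
    moreover have "q \<Oplus> (\<lambda>k. if k = m then p m else \<zero>) = p"
    proof
      fix k
      have "p k \<in> carrier R" "p m \<in> carrier R" using insert.prems K.a_subset by blast+
      then show "(q \<Oplus> (\<lambda>k. if k = m then p m else \<zero>)) k = p k"
        by (simp add: indexed_padd_def q_def)
    qed
    ultimately show ?case by simp
  qed
  then show "?poly p \<Longrightarrow> p \<in> (K [\<X>\<^bsub>I\<^esub>])" by blast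
qed

lemma additive_subgroup_carrier: "additive_subgroup (carrier R) R"
  using oneideal by (rule ideal.axioms)

lemma mpoly_carrier_iff:
  "p \<in> carrier (mpoly_ring R I) \<longleftrightarrow>
    (\<forall>m. p m \<in> carrier R) \<and> finite {m. p m \<noteq> \<zero>} \<and> (\<forall>m. p m \<noteq> \<zero> \<longrightarrow> set_mset m \<subseteq> I)"
  using indexed_pset_iff[OF additive_subgroup_carrier] by (simp add: mpoly_ring_def)

lemma mpoly_mult_coeff_closed:
  assumes "\<And>m. p m \<in> carrier R" "\<And>m. q m \<in> carrier R"
  shows "mpoly_mult R p q m \<in> carrier R"
  unfolding mpoly_mult_def using assms by (auto intro!: finsum_closed)

lemma mpoly_mult_nonzero:
  assumes "\<And>m. p m \<in> carrier R" "\<And>m. q m \<in> carrier R" "mpoly_mult R p q m \<noteq> \<zero>"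
  obtains k l where "k + l = m" "p k \<noteq> \<zero>" "q l \<noteq> \<zero>"
proof -
  have "\<exists>k l. k + l = m \<and> p k \<noteq> \<zero> \<and> q l \<noteq> \<zero>"
  proof (rule ccontr)
    assume "\<nexists>k l. k + l = m \<and> p k \<noteq> \<zero> \<and> q l \<noteq> \<zero>"
    then have "mpoly_mult R p q m = \<zero>"
      unfolding mpoly_mult_def using assms(1,2)
      by (intro add.finprod_one_eqI) (clarsimp, metis l_null r_null)
    then show False using assms by simp
  qed
  then show thesis using that by blast
qed

lemma mpoly_mult_closed:
  assumes "p \<in> carrier (mpoly_ring R I)" "q \<in> carrier (mpoly_ring R I)"
  shows "mpoly_mult R p q \<in> carrier (mpoly_ring R I)"
proof -
  note p = assms(1)[unfolded mpoly_carrier_iff] and q = assms(2)[unfolded mpoly_carrier_iff]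
  have nz: "\<exists>k l. k + l = m \<and> p k \<noteq> \<zero> \<and> q l \<noteq> \<zero>" if "mpoly_mult R p q m \<noteq> \<zero>" for m
    using mpoly_mult_nonzero[of p q m] that p q by metis
  have "finite {m. mpoly_mult R p q m \<noteq> \<zero>}"
  proof (rule finite_subset)
    show "{m. mpoly_mult R p q m \<noteq> \<zero>} \<subseteq> (\<lambda>(k, l). k + l) ` ({m. p m \<noteq> \<zero>} \<times> {m. q m \<noteq> \<zero>})"
      using nz by fastforce
    show "finite ((\<lambda>(k, l). k + l) ` ({m. p m \<noteq> \<zero>} \<times> {m. q m \<noteq> \<zero>}))"
      using p q by blast
  qed
  moreover have "set_mset m \<subseteq> I" if "mpoly_mult R p q m \<noteq> \<zero>" for m
    using nz[OF that] p q by (metis le_sup_iff set_mset_union)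
  ultimately show ?thesis
    unfolding mpoly_carrier_iff using p q by (auto intro!: mpoly_mult_coeff_closed)
qed

lemma mpoly_mult_const:
  assumes "r \<in> carrier R" "\<And>m. p m \<in> carrier R"
  shows "mpoly_mult R (indexed_const r) p m = r \<otimes> p m"
proof -
  have "mpoly_mult R (indexed_const r) p m
      = (\<Oplus>kl\<in>{(k, l). k + l = m}. if ({#}, m) = kl then (\<lambda>(k, l). r \<otimes> p l) kl else \<zero>)"
    unfolding mpoly_mult_def using assms
    by (intro finsum_cong') (auto simp: indexed_const_def split: if_splits)
  also have "\<dots> = r \<otimes> p m"
    by (rule trans[OF finsum_singleton]) (use assms in \<open>auto simp: finite_multiset_splittings\<close>)
  finally show ?thesis .
qed

end

context cring
begin

lemma mpoly_mult_comm:
  fixes p q :: "'c multiset \<Rightarrow> 'a"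
  assumes "\<And>m. p m \<in> carrier R" "\<And>m. q m \<in> carrier R"
  shows "mpoly_mult R p q = mpoly_mult R q p"
proof
  fix m :: "'c multiset"
  have swap: "{(k, l). k + l = m} = prod.swap ` {(k, l). k + l = m}"
    by (auto simp: union_commute image_iff)
  have "mpoly_mult R q p m = finsum R (\<lambda>(k, l). q k \<otimes> p l) (prod.swap ` {(k, l). k + l = m})"
    unfolding mpoly_mult_def using swap by simp
  also have "\<dots> = (\<Oplus>x\<in>{(k, l). k + l = m}. (\<lambda>(k, l). q k \<otimes> p l) (prod.swap x))"
    using assms by (intro finsum_reindex) auto
  also have "\<dots> = mpoly_mult R p q m"
    unfolding mpoly_mult_def using assms by (intro finsum_cong') (auto simp: m_comm)
  finally show "mpoly_mult R p q m = mpoly_mult R q p m" ..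
qed

text \<open>The right-hand side is symmetric in the three factors up to a permutation of the summation
  variables, so commutativity of the product gives associativity.\<close>

lemma mpoly_mult_mult_eq_triple_sum:
  assumes p: "\<And>m. p m \<in> carrier R" and q: "\<And>m. q m \<in> carrier R" and r: "\<And>m. r m \<in> carrier R"
  shows "mpoly_mult R (mpoly_mult R p q) r m = finsum R (\<lambda>(a, b, c). p a \<otimes> q b \<otimes> r c) {(a, b, c). a + b + c = m}"
proof -
  let ?g = "\<lambda>(a, b, c). p a \<otimes> q b \<otimes> r c"
  let ?T = "\<lambda>(k, c). (\<lambda>(a, b). (a, b, c)) ` {(a, b). a + b = k}"
  have "mpoly_mult R (mpoly_mult R p q) r m = (\<Oplus>x\<in>{(k, c). k + c = m}. finsum R ?g (?T x))"
    unfolding mpoly_mult_def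
  proof (intro finsum_cong')
    fix x assume "x \<in> {(k, c). k + c = m}"
    obtain k c where x: "x = (k, c)" by (cases x)
    have "finsum R ?g (?T x) = (\<Oplus>y\<in>{(a, b). a + b = k}. ?g (case y of (a, b) \<Rightarrow> (a, b, c)))"
      unfolding x using assms by (simp, intro finsum_reindex) (auto simp: inj_on_def)
    also have "\<dots> = (\<Oplus>y\<in>{(a, b). a + b = k}. (\<lambda>(a, b). p a \<otimes> q b) y \<otimes> r c)"
      using assms by (intro finsum_cong') auto
    also have "\<dots> = finsum R (\<lambda>(a, b). p a \<otimes> q b) {(a, b). a + b = k} \<otimes> r c"
      using assms by (subst finsum_ldistr) (auto simp: finite_multiset_splittings)
    finally show "(case x of (k, l) \<Rightarrow> finsum R (\<lambda>(k, l). p k \<otimes> q l) {(k', l). k' + l = k} \<otimes> r l) = finsum R ?g (?T x)"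
      unfolding x by simp
  qed (use assms in \<open>auto intro!: finsum_closed\<close>)
  also have "\<dots> = finsum R ?g (\<Union>(?T ` {(k, c). k + c = m}))"
    using assms by (intro add.finprod_UN_disjoint[symmetric])
      (auto simp: finite_multiset_splittings pairwise_def disjnt_def)
  also have "\<Union>(?T ` {(k, c). k + c = m}) = {(a, b, c). a + b + c = m}"
    by (auto simp: image_iff) 
  finally show ?thesis .
qed

lemma mpoly_mult_assoc:
  assumes p: "\<And>m. p m \<in> carrier R" and q: "\<And>m. q m \<in> carrier R" and r: "\<And>m. r m \<in> carrier R"
  shows "mpoly_mult R (mpoly_mult R p q) r = mpoly_mult R p (mpoly_mult R q r)"
proof
  fix m
  have "mpoly_mult R p (mpoly_mult R q r) m = mpoly_mult R (mpoly_mult R q r) p m"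
    using assms by (subst mpoly_mult_comm) (auto intro: mpoly_mult_coeff_closed)
  also have "\<dots> = finsum R (\<lambda>(a, b, c). q a \<otimes> r b \<otimes> p c) {(a, b, c). a + b + c = m}"
    using assms by (intro mpoly_mult_mult_eq_triple_sum)
  also have "{(a, b, c). a + b + c = m} = (\<lambda>(a, b, c). (b, c, a)) ` {(a, b, c). a + b + c = m}"
    by (auto simp: image_iff ac_simps)
  also have "finsum R (\<lambda>(a, b, c). q a \<otimes> r b \<otimes> p c) \<dots>
      = (\<Oplus>x\<in>{(a, b, c). a + b + c = m}. (\<lambda>(a, b, c). q a \<otimes> r b \<otimes> p c) ((\<lambda>(a, b, c). (b, c, a)) x))"
    using assms by (intro finsum_reindex) (auto simp: inj_on_def)
  also have "\<dots> = finsum R (\<lambda>(a, b, c). p a \<otimes> q b \<otimes> r c) {(a, b, c). a + b + c = m}"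
    using assms by (intro finsum_cong') (auto simp: m_ac)
  also have "\<dots> = mpoly_mult R (mpoly_mult R p q) r m"
    using assms by (intro mpoly_mult_mult_eq_triple_sum[symmetric])
  finally show "mpoly_mult R (mpoly_mult R p q) r m = mpoly_mult R p (mpoly_mult R q r) m" ..
qed

lemma mpoly_mult_distrib:
  assumes p: "\<And>m. p m \<in> carrier R" and q: "\<And>m. q m \<in> carrier R" and r: "\<And>m. r m \<in> carrier R"
  shows "mpoly_mult R (p \<Oplus> q) r = mpoly_mult R p r \<Oplus> mpoly_mult R q r"
proof
  fix m
  have "mpoly_mult R (p \<Oplus> q) r m
      = (\<Oplus>x\<in>{(k, l). k + l = m}. (\<lambda>(k, l). p k \<otimes> r l) x \<oplus> (\<lambda>(k, l). q k \<otimes> r l) x)"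
    unfolding mpoly_mult_def indexed_padd_def using assms
    by (intro finsum_cong') (auto simp: l_distr)
  also have "\<dots> = (mpoly_mult R p r \<Oplus> mpoly_mult R q r) m"
    unfolding mpoly_mult_def indexed_padd_def using assms by (intro finsum_addf) auto
  finally show "mpoly_mult R (p \<Oplus> q) r m = (mpoly_mult R p r \<Oplus> mpoly_mult R q r) m" .
qed

lemma cring_mpoly_ring: "cring (mpoly_ring R I)"
proof (rule cringI)
  note carr = mpoly_carrier_iff
  have coeff: "p m \<in> carrier R" if "p \<in> carrier (mpoly_ring R I)" for p m
    using that carr by blast
  have const: "indexed_const r \<in> carrier (mpoly_ring R I)" if "r \<in> carrier R" for r
    using that by (simp add: mpoly_ring_def indexed_pset.indexed_const)
  show "abelian_group (mpoly_ring R I)"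
  proof (rule abelian_groupI)
    fix p assume p: "p \<in> carrier (mpoly_ring R I)"
    have "(\<lambda>m. \<ominus> p m) \<in> carrier (mpoly_ring R I)"
      using p unfolding carr by (auto elim: finite_subset[rotated])
    moreover have "(\<lambda>m. \<ominus> p m) \<oplus>\<^bsub>mpoly_ring R I\<^esub> p = \<zero>\<^bsub>mpoly_ring R I\<^esub>"
      using coeff[OF p] by (auto simp: mpoly_ring_def indexed_padd_def indexed_const_def l_neg)
    ultimately show "\<exists>q\<in>carrier (mpoly_ring R I). q \<oplus>\<^bsub>mpoly_ring R I\<^esub> p = \<zero>\<^bsub>mpoly_ring R I\<^esub>"
      by blast
    show "\<zero>\<^bsub>mpoly_ring R I\<^esub> \<oplus>\<^bsub>mpoly_ring R I\<^esub> p = p"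
      using coeff[OF p] by (auto simp: mpoly_ring_def indexed_padd_def indexed_const_def)
  next
    show "\<zero>\<^bsub>mpoly_ring R I\<^esub> \<in> carrier (mpoly_ring R I)"
      using const by (simp add: mpoly_ring_def)
  next
    fix p q r
    assume pq: "p \<in> carrier (mpoly_ring R I)" "q \<in> carrier (mpoly_ring R I)"
    then show "p \<oplus>\<^bsub>mpoly_ring R I\<^esub> q \<in> carrier (mpoly_ring R I)"
      by (simp add: mpoly_ring_def indexed_pset.indexed_padd)
    show "p \<oplus>\<^bsub>mpoly_ring R I\<^esub> q = q \<oplus>\<^bsub>mpoly_ring R I\<^esub> p"
      using pq[THEN coeff] by (simp add: mpoly_ring_def indexed_padd_def a_comm)
    assume "r \<in> carrier (mpoly_ring R I)"
    with pq show "p \<oplus>\<^bsub>mpoly_ring R I\<^esub> q \<oplus>\<^bsub>mpoly_ring R I\<^esub> r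
        = p \<oplus>\<^bsub>mpoly_ring R I\<^esub> (q \<oplus>\<^bsub>mpoly_ring R I\<^esub> r)"
      using coeff by (simp add: mpoly_ring_def indexed_padd_def a_assoc)
  qed
  show "comm_monoid (mpoly_ring R I)"
  proof (rule comm_monoidI)
    show "\<one>\<^bsub>mpoly_ring R I\<^esub> \<in> carrier (mpoly_ring R I)"
      using const by (simp add: mpoly_ring_def)
  next
    fix p q r assume p: "p \<in> carrier (mpoly_ring R I)"
    then show "\<one>\<^bsub>mpoly_ring R I\<^esub> \<otimes>\<^bsub>mpoly_ring R I\<^esub> p = p"
      using coeff[OF p] by (auto simp: mpoly_ring_def mpoly_mult_const)
    assume q: "q \<in> carrier (mpoly_ring R I)"
    with p show "p \<otimes>\<^bsub>mpoly_ring R I\<^esub> q \<in> carrier (mpoly_ring R I)"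
      using mpoly_mult_closed by (simp add: mpoly_ring_def)
    show "p \<otimes>\<^bsub>mpoly_ring R I\<^esub> q = q \<otimes>\<^bsub>mpoly_ring R I\<^esub> p"
      using mpoly_mult_comm[OF coeff[OF p] coeff[OF q]] by (simp add: mpoly_ring_def)
    assume r: "r \<in> carrier (mpoly_ring R I)"
    show "p \<otimes>\<^bsub>mpoly_ring R I\<^esub> q \<otimes>\<^bsub>mpoly_ring R I\<^esub> r
        = p \<otimes>\<^bsub>mpoly_ring R I\<^esub> (q \<otimes>\<^bsub>mpoly_ring R I\<^esub> r)"
      using mpoly_mult_assoc[OF coeff[OF p] coeff[OF q] coeff[OF r]] by (simp add: mpoly_ring_def)
  qed
  show "(p \<oplus>\<^bsub>mpoly_ring R I\<^esub> q) \<otimes>\<^bsub>mpoly_ring R I\<^esub> r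
      = p \<otimes>\<^bsub>mpoly_ring R I\<^esub> r \<oplus>\<^bsub>mpoly_ring R I\<^esub> q \<otimes>\<^bsub>mpoly_ring R I\<^esub> r"
    if "p \<in> carrier (mpoly_ring R I)" "q \<in> carrier (mpoly_ring R I)" "r \<in> carrier (mpoly_ring R I)"
    for p q r
    using mpoly_mult_distrib[OF that(1)[THEN coeff] that(2)[THEN coeff] that(3)[THEN coeff]]
    by (simp add: mpoly_ring_def)
qed

end

lemma (in ideal) finsum_in_ideal:
  assumes "\<And>x. x \<in> B \<Longrightarrow> h x \<in> I"
  shows "finsum R h B \<in> I"
  using assms
proof (induction B rule: infinite_finite_induct)
  case (insert x B)
  then have "h \<in> B \<rightarrow> carrier R" "h x \<in> carrier R" using a_subset by auto
  then show ?case using insert by (simp add: finsum_insert)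
qed (auto simp: finsum_infinite)

context cring
begin

text \<open>Modulo an ideal, one coefficient of a product is often a single product of coefficients. This
  serves for leading coefficients modulo a prime ideal, for multiplication by a variable, and for the
  top degree in one variable.\<close>

lemma mpoly_mult_single_term:
  assumes J: "ideal J R" and p: "\<And>m. p m \<in> carrier R" and q: "\<And>m. q m \<in> carrier R"
    and rest: "\<And>k l. k + l = a + b \<Longrightarrow> k \<noteq> a \<Longrightarrow> p k \<otimes> q l \<in> J"
  shows "\<exists>x\<in>J. mpoly_mult R p q (a + b) = p a \<otimes> q b \<oplus> x"
proof
  interpret J: ideal J R by fact
  let ?D = "{(k, l). k + l = a + b}" and ?t = "\<lambda>(k, l). p k \<otimes> q l"
  have D: "?D = insert (a, b) (?D - {(a, b)})" by auto
  have "mpoly_mult R p q (a + b) = finsum R ?t (insert (a, b) (?D - {(a, b)}))"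
    unfolding mpoly_mult_def using D by simp
  also have "\<dots> = ?t (a, b) \<oplus> finsum R ?t (?D - {(a, b)})"
    using p q by (intro finsum_insert) (auto simp: finite_multiset_splittings)
  finally show "mpoly_mult R p q (a + b) = p a \<otimes> q b \<oplus> finsum R ?t (?D - {(a, b)})"
    by simp
  show "finsum R ?t (?D - {(a, b)}) \<in> J"
  proof (rule J.finsum_in_ideal)
    fix kl assume "kl \<in> ?D - {(a, b)}"
    then obtain k l where "kl = (k, l)" "k + l = a + b" "k \<noteq> a" by (cases kl; cases "fst kl = a") auto
    then show "?t kl \<in> J" using rest by simp
  qed
qed

lemma indexed_pset_ideal:
  assumes J: "ideal J R"
  shows "ideal (J [\<X>\<^bsub>I\<^esub>]) (mpoly_ring R I)"
proof -
  interpret J: ideal J R by fact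
  interpret P: cring "mpoly_ring R I" by (rule cring_mpoly_ring)
  have iff: "p \<in> (J [\<X>\<^bsub>I\<^esub>]) \<longleftrightarrow> p \<in> carrier (mpoly_ring R I) \<and> (\<forall>m. p m \<in> J)" for p
    unfolding mpoly_carrier_iff indexed_pset_iff[OF J.additive_subgroup_axioms]
    using J.a_subset by blast
  have add: "p \<oplus>\<^bsub>mpoly_ring R I\<^esub> q = (\<lambda>m. p m \<oplus> q m)" for p q
    by (simp add: mpoly_ring_def indexed_padd_def)
  have mult: "p \<otimes>\<^bsub>mpoly_ring R I\<^esub> q = mpoly_mult R p q" for p q
    by (simp add: mpoly_ring_def)
  have J_mult: "p \<otimes>\<^bsub>mpoly_ring R I\<^esub> q \<in> (J [\<X>\<^bsub>I\<^esub>])"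
    if p: "p \<in> (J [\<X>\<^bsub>I\<^esub>])" and q: "q \<in> carrier (mpoly_ring R I)" for p q
  proof -
    have "p k \<otimes> q l \<in> J" for k l
      using p q unfolding iff mpoly_carrier_iff by (blast intro: J.I_r_closed)
    then have "mpoly_mult R p q m \<in> J" for m
      unfolding mpoly_mult_def by (intro J.finsum_in_ideal) auto
    moreover have "mpoly_mult R p q \<in> carrier (mpoly_ring R I)"
      using p q iff by (intro mpoly_mult_closed) blast+
    ultimately show ?thesis unfolding iff mult by blast
  qed
  show ?thesis
  proof (rule idealI[OF P.ring_axioms])
    show "subgroup (J [\<X>\<^bsub>I\<^esub>]) (add_monoid (mpoly_ring R I))"
    proof (rule P.add.subgroupI)
      show "(J [\<X>\<^bsub>I\<^esub>]) \<subseteq> carrier (mpoly_ring R I)" using iff by blast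
      show "(J [\<X>\<^bsub>I\<^esub>]) \<noteq> {}" using indexed_pset.indexed_const[OF J.zero_closed] by blast
      show "p \<oplus>\<^bsub>mpoly_ring R I\<^esub> q \<in> (J [\<X>\<^bsub>I\<^esub>])" if "p \<in> (J [\<X>\<^bsub>I\<^esub>])" "q \<in> (J [\<X>\<^bsub>I\<^esub>])" for p q
        using that by (simp add: mpoly_ring_def indexed_pset.indexed_padd)
      show "\<ominus>\<^bsub>mpoly_ring R I\<^esub> p \<in> (J [\<X>\<^bsub>I\<^esub>])" if p: "p \<in> (J [\<X>\<^bsub>I\<^esub>])" for p
      proof -
        have pc: "p \<in> carrier (mpoly_ring R I)" using p iff by blast
        have "\<ominus>\<^bsub>mpoly_ring R I\<^esub> p = p \<otimes>\<^bsub>mpoly_ring R I\<^esub> (\<ominus>\<^bsub>mpoly_ring R I\<^esub> \<one>\<^bsub>mpoly_ring R I\<^esub>)"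
          using pc by (simp add: P.r_minus)
        then show ?thesis using J_mult[OF p] by simp
      qed
    qed
  next
    fix p q assume p: "p \<in> (J [\<X>\<^bsub>I\<^esub>])" and q: "q \<in> carrier (mpoly_ring R I)"
    then show "p \<otimes>\<^bsub>mpoly_ring R I\<^esub> q \<in> (J [\<X>\<^bsub>I\<^esub>])" by (rule J_mult)
    moreover have "p \<in> carrier (mpoly_ring R I)" using p iff by blast
    ultimately show "q \<otimes>\<^bsub>mpoly_ring R I\<^esub> p \<in> (J [\<X>\<^bsub>I\<^esub>])"
      using P.m_comm[OF _ q] by simp
  qed
qed

text \<open>Compare leading coefficients modulo \<open>\<pp>\<close>: for a linear order of the monomials that is compatible
  with multiplication, such as the multiset order, the product of the last coefficients
  outside \<open>\<pp>\<close> is a coefficient of the product modulo \<open>\<pp>\<close>.\<close>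

lemma indexed_pset_primeideal:
  fixes I :: "'c :: linorder set"
  assumes \<pp>: "primeideal \<pp> R"
  shows "primeideal (\<pp> [\<X>\<^bsub>I\<^esub>]) (mpoly_ring R I)"
proof -
  interpret \<pp>: primeideal \<pp> R by fact
  interpret P: cring "mpoly_ring R I" by (rule cring_mpoly_ring)
  have iff: "p \<in> (\<pp> [\<X>\<^bsub>I\<^esub>]) \<longleftrightarrow> p \<in> carrier (mpoly_ring R I) \<and> (\<forall>m. p m \<in> \<pp>)" for p
    unfolding mpoly_carrier_iff indexed_pset_iff[OF \<pp>.additive_subgroup_axioms]
    using \<pp>.a_subset by blast
  have leading: "\<exists>a. p a \<notin> \<pp> \<and> (\<forall>m>a. p m \<in> \<pp>)"
    if p: "p \<in> carrier (mpoly_ring R I)" "p \<notin> (\<pp> [\<X>\<^bsub>I\<^esub>])" for p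
  proof -
    let ?M = "{m. p m \<notin> \<pp>}"
    have fin: "finite ?M"
      by (rule finite_subset[of _ "{m. p m \<noteq> \<zero>}"]) (use p(1)[unfolded mpoly_carrier_iff] in auto)
    have "?M \<noteq> {}" using p iff by blast
    then have "Max ?M \<in> ?M" using fin by (rule Max_in[rotated])
    moreover have "p m \<in> \<pp>" if "m > Max ?M" for m
      using Max_ge[OF fin, of m] that by (auto simp: not_le[symmetric])
    ultimately show ?thesis by blast
  qed
  show ?thesis
  proof (rule primeidealI[OF indexed_pset_ideal[OF \<pp>.ideal_axioms] P.cring_axioms])
    have "indexed_const \<one> \<in> carrier (mpoly_ring R I)"
      by (simp add: mpoly_ring_def indexed_pset.indexed_const)
    moreover have "\<one> \<notin> \<pp>" using \<pp>.I_notcarr \<pp>.one_imp_carrier by blast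
    then have "indexed_const \<one> \<notin> (\<pp> [\<X>\<^bsub>I\<^esub>])"
      unfolding iff by (auto simp: indexed_const_def intro!: exI[of _ "{#}"])
    ultimately show "carrier (mpoly_ring R I) \<noteq> (\<pp> [\<X>\<^bsub>I\<^esub>])" by blast
  next
    fix p q
    assume p: "p \<in> carrier (mpoly_ring R I)" and q: "q \<in> carrier (mpoly_ring R I)"
      and pq: "p \<otimes>\<^bsub>mpoly_ring R I\<^esub> q \<in> (\<pp> [\<X>\<^bsub>I\<^esub>])"
    show "p \<in> (\<pp> [\<X>\<^bsub>I\<^esub>]) \<or> q \<in> (\<pp> [\<X>\<^bsub>I\<^esub>])"
    proof (rule ccontr)
      assume "\<not> ?thesis"
      then have "p \<notin> (\<pp> [\<X>\<^bsub>I\<^esub>])" "q \<notin> (\<pp> [\<X>\<^bsub>I\<^esub>])" by simp_all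
      from leading[OF p this(1)] leading[OF q this(2)]
      obtain a b where a: "p a \<notin> \<pp>" "\<forall>m>a. p m \<in> \<pp>" and b: "q b \<notin> \<pp>" "\<forall>m>b. q m \<in> \<pp>"
        by (elim exE conjE)
      have coeff: "p m \<in> carrier R" "q m \<in> carrier R" for m
        using p q unfolding mpoly_carrier_iff by blast+
      have rest: "p k \<otimes> q l \<in> \<pp>" if kl: "k + l = a + b" "k \<noteq> a" for k l
      proof (cases "k > a")
        case True
        then have "p k \<in> \<pp>" using a by simp
        then show ?thesis using coeff(2) by (rule \<pp>.I_r_closed)
      next
        case False
        then have "k < a" using kl(2) by simp
        have "l > b"
        proof (rule ccontr)
          assume "\<not> l > b"
          with \<open>k < a\<close> have "k + l < a + b" by (intro add_less_le_mono) auto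
          then show False using kl(1) by simp
        qed
        then have "q l \<in> \<pp>" using b by simp
        then show ?thesis using coeff(1) by (rule \<pp>.I_l_closed)
      qed
      have "\<exists>x\<in>\<pp>. mpoly_mult R p q (a + b) = p a \<otimes> q b \<oplus> x"
        by (rule mpoly_mult_single_term[OF \<pp>.ideal_axioms]) (use coeff rest in auto)
      then obtain x where x: "x \<in> \<pp>" "mpoly_mult R p q (a + b) = p a \<otimes> q b \<oplus> x"
        by (elim bexE)
      have "mpoly_mult R p q \<in> (\<pp> [\<X>\<^bsub>I\<^esub>])"
        using pq by (simp add: mpoly_ring_def)
      then have "mpoly_mult R p q (a + b) \<in> \<pp>"
        unfolding iff by blast
      then have "p a \<otimes> q b \<oplus> x \<ominus> x \<in> \<pp>"
        unfolding x(2) a_minus_def using x(1) by simp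
      moreover have "p a \<otimes> q b \<oplus> x \<ominus> x = p a \<otimes> q b"
        using coeff x(1) \<pp>.Icarr by (simp add: a_minus_def a_assoc r_neg)
      ultimately have "p a \<otimes> q b \<in> \<pp>" by simp
      then show False using \<pp>.I_prime[OF coeff(1) coeff(2)] a(1) b(1) by blast
    qed
  qed
qed

lemma mpoly_carrier_mono:
  "I \<subseteq> I' \<Longrightarrow> carrier (mpoly_ring R I) \<subseteq> carrier (mpoly_ring R I')"
  unfolding mpoly_carrier_iff subset_iff by blast

lemma indexed_var_in_mpoly: "i \<in> I \<Longrightarrow> indexed_var i \<in> carrier (mpoly_ring R I)"
  unfolding mpoly_ring_def indexed_var_def partial_object.simps
  by (intro indexed_pset.indexed_pmult indexed_pset.indexed_const) auto

lemma indexed_const_in_mpoly: "r \<in> carrier R \<Longrightarrow> indexed_const r \<in> carrier (mpoly_ring R I)"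
  by (simp add: mpoly_ring_def indexed_pset.indexed_const)

lemma indexed_var_apply:
  "indexed_var i m = (if m = {#i#} then \<one> else \<zero>)"
proof (cases "i \<in># m")
  case True
  then obtain a where "m = add_mset i a" by (metis insert_DiffM)
  then show ?thesis by (simp add: indexed_var_def indexed_pmult_def indexed_const_def)
qed (auto simp: indexed_var_def indexed_pmult_def)

lemma mpoly_mult_var:
  fixes p :: "'c multiset \<Rightarrow> 'a"
  assumes p: "\<And>m. p m \<in> carrier R"
  shows "mpoly_mult R p (indexed_var i) = p \<Otimes> i"
proof
  fix m :: "'c multiset"
  have var: "indexed_var i l \<in> carrier R" for l by (simp add: indexed_var_apply)
  show "mpoly_mult R p (indexed_var i) m = (p \<Otimes> i) m"
  proof (cases "i \<in># m")
    case True
    then obtain a where m: "m = a + {#i#}" by (metis insert_DiffM2)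
    have "p k \<otimes> indexed_var i l \<in> {\<zero>}" if "k + l = a + {#i#}" "k \<noteq> a" for k l
      using that p by (auto simp: indexed_var_apply)
    then have "mpoly_mult R p (indexed_var i) m = p a \<otimes> indexed_var i {#i#} \<oplus> \<zero>"
      unfolding m using mpoly_mult_single_term[OF zeroideal p var, of a "{#i#}"] by auto
    then show ?thesis using p by (simp add: m indexed_var_apply indexed_pmult_def)
  next
    case False
    have "mpoly_mult R p (indexed_var i) m = \<zero>"
    proof (rule ccontr)
      assume "mpoly_mult R p (indexed_var i) m \<noteq> \<zero>"
      with p var obtain k l where "k + l = m" "indexed_var i l \<noteq> \<zero>"
        by (rule mpoly_mult_nonzero)
      then show False using False by (auto simp: indexed_var_apply split: if_splits)
    qed
    then show ?thesis using False by (simp add: indexed_pmult_def)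
  qed
qed

lemma mpoly_finsum_apply:
  assumes "finite B" "\<And>i. i \<in> B \<Longrightarrow> h i \<in> carrier (mpoly_ring R I)"
  shows "finsum (mpoly_ring R I) h B m = (\<Oplus>i\<in>B. h i m)"
  using assms
proof (induction B rule: finite_induct)
  case empty
  interpret P: cring "mpoly_ring R I" by (rule cring_mpoly_ring)
  show ?case unfolding P.finsum_empty finsum_empty by (simp add: mpoly_ring_def indexed_const_def)
next
  case (insert i B)
  interpret P: cring "mpoly_ring R I" by (rule cring_mpoly_ring)
  have "h j m \<in> carrier R" if "j \<in> insert i B" for j
    using insert.prems[OF that] mpoly_carrier_iff by blast
  then have "(\<Oplus>i\<in>insert i B. h i m) = h i m \<oplus> (\<Oplus>i\<in>B. h i m)"
    using insert.hyps by (intro finsum_insert) auto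
  moreover have "finsum (mpoly_ring R I) h (insert i B) = h i \<oplus>\<^bsub>mpoly_ring R I\<^esub> finsum (mpoly_ring R I) h B"
    using insert by (intro P.finsum_insert) auto
  ultimately show ?case using insert by (simp add: mpoly_ring_def indexed_padd_def)
qed

end

lemma (in domain) domain_mpoly_ring: "domain (mpoly_ring R (I :: 'c :: linorder set))"
proof -
  interpret P: cring "mpoly_ring R I" by (rule cring_mpoly_ring)
  have "p \<in> ({\<zero>} [\<X>\<^bsub>I\<^esub>]) \<longleftrightarrow> p = \<zero>\<^bsub>mpoly_ring R I\<^esub>" for p
    unfolding indexed_pset_iff[OF ideal.axioms(1)[OF zeroideal]]
    by (auto simp: mpoly_ring_def indexed_const_def)
  then have "({\<zero>} [\<X>\<^bsub>I\<^esub>]) = {\<zero>\<^bsub>mpoly_ring R I\<^esub>}" by blast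
  with indexed_pset_primeideal[OF zeroprimeideal, of I] show ?thesis
    using P.zeroprimeideal_domainI by simp
qed

section \<open>The forcing polynomial\<close>

context cring
begin

context
  fixes n :: nat and f :: "nat \<Rightarrow> 'a" and g :: 'a
  assumes f: "\<And>i. i \<in> {1..n} \<Longrightarrow> f i \<in> carrier R" and g: "g \<in> carrier R"
begin

lemma forcing_polynomial_summand:
  assumes "i \<in> {1..n}"
  shows "indexed_const (f i) \<otimes>\<^bsub>mpoly_ring R {1..n}\<^esub> indexed_var i = (\<lambda>m. if m = {#i#} then f i else \<zero>)"
proof
  fix m
  have "mpoly_mult R (indexed_const (f i)) (indexed_var i) m = f i \<otimes> indexed_var i m"
    using f assms by (intro mpoly_mult_const) (auto simp: indexed_var_apply)
  then show "(indexed_const (f i) \<otimes>\<^bsub>mpoly_ring R {1..n}\<^esub> indexed_var i) m = (if m = {#i#} then f i else \<zero>)"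
    using f assms by (simp add: mpoly_ring_def indexed_var_apply)
qed

lemma forcing_polynomial_closed: "forcing_polynomial R n f g \<in> carrier (mpoly_ring R {1..n})"
proof -
  interpret P: cring "mpoly_ring R {1..n}" by (rule cring_mpoly_ring)
  show ?thesis
    unfolding forcing_polynomial_def Let_def using f g
    by (intro P.a_closed P.finsum_closed funcsetI P.m_closed indexed_const_in_mpoly indexed_var_in_mpoly)
qed

lemma forcing_polynomial_apply:
  "forcing_polynomial R n f g m = (\<Oplus>i\<in>{1..n}. if m = {#i#} then f i else \<zero>) \<oplus> (if m = {#} then g else \<zero>)"
proof -
  interpret P: cring "mpoly_ring R {1..n}" by (rule cring_mpoly_ring)
  let ?h = "\<lambda>i. indexed_const (f i) \<otimes>\<^bsub>mpoly_ring R {1..n}\<^esub> indexed_var i"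
  have "finsum (mpoly_ring R {1..n}) ?h {1..n} m = (\<Oplus>i\<in>{1..n}. ?h i m)"
    using f by (intro mpoly_finsum_apply P.m_closed indexed_const_in_mpoly indexed_var_in_mpoly) auto
  also have "\<dots> = (\<Oplus>i\<in>{1..n}. if m = {#i#} then f i else \<zero>)"
  proof (intro finsum_cong')
    show "?h i m = (if m = {#i#} then f i else \<zero>)" if "i \<in> {1..n}" for i
      by (rule fun_cong[OF forcing_polynomial_summand[OF that]])
  qed (use f in auto)
  finally show ?thesis
    unfolding forcing_polynomial_def Let_def
    by (simp add: mpoly_ring_def indexed_padd_def indexed_const_def)
qed

lemma forcing_polynomial_const: "forcing_polynomial R n f g {#} = g"
  using g by (simp add: forcing_polynomial_apply)

lemma forcing_polynomial_linear:
  assumes "i \<in> {1..n}"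
  shows "forcing_polynomial R n f g {#i#} = f i"
proof -
  have "(\<Oplus>j\<in>{1..n}. if {#i#} = {#j#} then f j else \<zero>) = (\<Oplus>j\<in>{1..n}. if i = j then f j else \<zero>)"
    by simp
  also have "\<dots> = f i"
    using assms f by (intro finsum_singleton) auto
  finally show ?thesis using f[OF assms] by (simp add: forcing_polynomial_apply)
qed

lemma forcing_polynomial_support:
  assumes "forcing_polynomial R n f g m \<noteq> \<zero>"
  shows "m = {#} \<or> (\<exists>i\<in>{1..n}. m = {#i#})"
proof (rule ccontr)
  assume neg: "\<not> ?thesis"
  then have "(\<Oplus>i\<in>{1..n}. if m = {#i#} then f i else \<zero>) = \<zero>"
    by (intro add.finprod_one_eqI) auto
  then show False using neg assms by (simp add: forcing_polynomial_apply)
qed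

end

end

text \<open>For \<open>v \<noteq> 0\<close>, multiplication by the forcing polynomial raises the degree in \<open>T\<^sub>i\<close> by one: take a
  monomial \<open>a\<close> of \<open>v\<close> with the largest exponent of \<open>T\<^sub>i\<close>. The only contribution to the coefficient of
  \<open>a T\<^sub>i\<close> comes from \<open>f\<^sub>i T\<^sub>i\<close>. So a multiple that does not involve \<open>T\<^sub>i\<close> must be zero.\<close>

lemma (in domain) forcing_multiple_free_of_var_eq_zero:
  assumes f: "\<And>i. i \<in> {1..n} \<Longrightarrow> f i \<in> carrier R" and g: "g \<in> carrier R"
    and i: "i \<in> {1..n}" "f i \<noteq> \<zero>"
    and v: "v \<in> carrier (mpoly_ring R {1..n})"
    and h: "v \<otimes>\<^bsub>mpoly_ring R {1..n}\<^esub> forcing_polynomial R n f g \<in> carrier (mpoly_ring R ({1..n} - {i}))"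
  shows "v \<otimes>\<^bsub>mpoly_ring R {1..n}\<^esub> forcing_polynomial R n f g = \<zero>\<^bsub>mpoly_ring R {1..n}\<^esub>"
proof (rule ccontr)
  let ?F = "forcing_polynomial R n f g"
  interpret P: cring "mpoly_ring R {1..n}" by (rule cring_mpoly_ring)
  have Fclosed: "?F \<in> carrier (mpoly_ring R {1..n})" by (rule forcing_polynomial_closed[OF f g])
  assume "\<not> ?thesis"
  then have "v \<noteq> \<zero>\<^bsub>mpoly_ring R {1..n}\<^esub>" using P.l_null[OF Fclosed] by metis
  then have ne: "{m. v m \<noteq> \<zero>} \<noteq> {}" by (auto simp: mpoly_ring_def indexed_const_def)
  have fin: "finite {m. v m \<noteq> \<zero>}" using v mpoly_carrier_iff by blast
  obtain a where a: "v a \<noteq> \<zero>" "\<And>m. v m \<noteq> \<zero> \<Longrightarrow> count m i \<le> count a i"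
  proof -
    have "Max ((\<lambda>m. count m i) ` {m. v m \<noteq> \<zero>}) \<in> (\<lambda>m. count m i) ` {m. v m \<noteq> \<zero>}"
      using ne fin by (intro Max_in) auto
    then obtain a where "v a \<noteq> \<zero>" "count a i = Max ((\<lambda>m. count m i) ` {m. v m \<noteq> \<zero>})" by auto
    with fin show thesis by (intro that[of a]) auto
  qed
  have coeff: "v m \<in> carrier R" "?F m \<in> carrier R" for m
    using v Fclosed mpoly_carrier_iff by blast+
  have rest: "v k \<otimes> ?F l \<in> {\<zero>}" if kl: "k + l = a + {#i#}" "k \<noteq> a" for k l
  proof (rule ccontr)
    assume "v k \<otimes> ?F l \<notin> {\<zero>}"
    then have nz: "v k \<noteq> \<zero>" "?F l \<noteq> \<zero>" using coeff by auto
    have "l \<noteq> {#i#}" using kl by auto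
    then have "count l i = 0"
      using forcing_polynomial_support[OF f g nz(2)] by (auto split: if_splits)
    moreover have "count (k + l) i = Suc (count a i)" using kl by simp
    ultimately show False using a(2)[OF nz(1)] by simp
  qed
  have "\<exists>x\<in>{\<zero>}. mpoly_mult R v ?F (a + {#i#}) = v a \<otimes> ?F {#i#} \<oplus> x"
    by (rule mpoly_mult_single_term[OF zeroideal coeff(1) coeff(2)]) (rule rest)
  then obtain x where "x \<in> {\<zero>}" "mpoly_mult R v ?F (a + {#i#}) = v a \<otimes> ?F {#i#} \<oplus> x"
    by (elim bexE)
  then have "mpoly_mult R v ?F (a + {#i#}) = v a \<otimes> f i"
    using forcing_polynomial_linear[OF f g i(1)] coeff f[OF i(1)] by simp
  also have "\<dots> \<noteq> \<zero>" using a i coeff f[OF i(1)] integral_iff by simp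
  finally have nz: "mpoly_mult R v ?F (a + {#i#}) \<noteq> \<zero>" .
  have "v \<otimes>\<^bsub>mpoly_ring R {1..n}\<^esub> ?F = mpoly_mult R v ?F" by (simp add: mpoly_ring_def)
  with h nz have "set_mset (a + {#i#}) \<subseteq> {1..n} - {i}"
    unfolding mpoly_carrier_iff by metis
  then show False by simp
qed

section \<open>The forcing algebra\<close>

\<comment> \<open>Keeps the simplifier from rewriting the index set \<open>{1..n}\<close> inside \<open>mpoly_ring R {1..n}\<close>, which
  would make it unrecognizable to the rules below.\<close>
declare One_nat_def [simp del]

locale forcing_data = domain R for R :: "('a, 'b) ring_scheme" (structure) +
  fixes n :: nat and f :: "nat \<Rightarrow> 'a" and g :: 'a
  assumes f_closed: "\<And>i. i \<in> {1..n} \<Longrightarrow> f i \<in> carrier R"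
    and g_closed: "g \<in> carrier R"
    and f_nonzero: "\<exists>i\<in>{1..n}. f i \<noteq> \<zero>"
begin

abbreviation "P \<equiv> mpoly_ring R {1..n}"
abbreviation "F \<equiv> forcing_polynomial R n f g"
abbreviation "J \<equiv> forcing_ideal R n f g"
abbreviation "A \<equiv> forcing_algebra R n f g"
abbreviation "\<phi> \<equiv> forcing_map R n f g"
abbreviation "\<pi> \<equiv> (+>\<^bsub>P\<^esub>) J"

lemma cring_P: "cring P" by (rule cring_mpoly_ring)

lemma F_closed: "F \<in> carrier P"
  using f_closed g_closed by (rule forcing_polynomial_closed)

lemma F_const: "F {#} = g"
  using f_closed g_closed by (rule forcing_polynomial_const)

lemma F_linear: "i \<in> {1..n} \<Longrightarrow> F {#i#} = f i"
  using f_closed g_closed by (rule forcing_polynomial_linear)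

lemma F_support: "F m \<noteq> \<zero> \<Longrightarrow> m = {#} \<or> (\<exists>i\<in>{1..n}. m = {#i#})"
  using f_closed g_closed by (rule forcing_polynomial_support)

lemma ideal_J: "ideal J P"
proof -
  interpret P: cring P by (rule cring_P)
  show ?thesis unfolding forcing_ideal_def using F_closed by (intro P.genideal_ideal) simp
qed

lemma forcing_algebra_hom: "ring_hom_cring P A \<pi>"
  unfolding forcing_algebra_def by (rule ideal.rcos_ring_hom_cring[OF ideal_J cring_P])

lemma cring_A: "cring A"
  using forcing_algebra_hom by (rule ring_hom_cring.axioms)

lemma forcing_map_eq: "\<phi> r = \<pi> (indexed_const r)"
  by (simp add: forcing_map_def)

lemma forcing_map_hom: "ring_hom_cring R A \<phi>"
proof -
  interpret \<pi>: ring_hom_cring P A \<pi> by (rule forcing_algebra_hom)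
  have const: "indexed_const r \<in> carrier P" if "r \<in> carrier R" for r
    using that by (rule indexed_const_in_mpoly)
  show ?thesis
  proof (rule RingHom.ring_hom_cringI[OF ring_hom_ringI])
    fix r s assume r: "r \<in> carrier R" and s: "s \<in> carrier R"
    show "\<phi> r \<in> carrier A" unfolding forcing_map_eq using const[OF r] by simp
    have "indexed_const (r \<otimes> s) = indexed_const r \<otimes>\<^bsub>P\<^esub> indexed_const s"
    proof
      fix m :: "nat multiset"
      have "indexed_const s k \<in> carrier R" for k :: "nat multiset"
        using s by (simp add: indexed_const_def)
      then have "mpoly_mult R (indexed_const r) (indexed_const s) m = r \<otimes> indexed_const s m"
        using r by (intro mpoly_mult_const)
      then show "indexed_const (r \<otimes> s) m = (indexed_const r \<otimes>\<^bsub>P\<^esub> indexed_const s) m"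
        using r by (simp add: mpoly_ring_def indexed_const_def)
    qed
    then show "\<phi> (r \<otimes> s) = \<phi> r \<otimes>\<^bsub>A\<^esub> \<phi> s"
      unfolding forcing_map_eq using const[OF r] const[OF s] by simp
    have "indexed_const (r \<oplus> s) = indexed_const r \<oplus>\<^bsub>P\<^esub> indexed_const s"
      using r s by (simp add: mpoly_ring_def indexed_padd_const)
    then show "\<phi> (r \<oplus> s) = \<phi> r \<oplus>\<^bsub>A\<^esub> \<phi> s"
      unfolding forcing_map_eq using const[OF r] const[OF s] by simp
  next
    have "indexed_const \<one> = \<one>\<^bsub>P\<^esub>" by (simp add: mpoly_ring_def)
    then show "\<phi> \<one> = \<one>\<^bsub>A\<^esub>" unfolding forcing_map_eq by simp
  qed (use ring_axioms cring_axioms cring_A cring.axioms(1)[OF cring_A] in auto)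
qed

lemma carrier_A: "carrier A = \<pi> ` carrier P"
  unfolding forcing_algebra_def FactRing_def A_RCOSETS_def' by auto

lemma proj_eq_zero_iff:
  assumes "h \<in> carrier P"
  shows "\<pi> h = \<zero>\<^bsub>A\<^esub> \<longleftrightarrow> h \<in> J"
proof -
  interpret P: cring P by (rule cring_P)
  have zero: "\<zero>\<^bsub>A\<^esub> = J" by (simp add: forcing_algebra_def FactRing_def)
  show ?thesis
    unfolding zero using P.a_rcos_zero[OF ideal_J] ideal.rcos_const_imp_mem[OF ideal_J assms] by blast
qed

lemma proj_image_primeideal:
  assumes K: "primeideal K P" and JK: "J \<subseteq> K"
  shows "primeideal (\<pi> ` K) A"
proof (rule primeidealI[OF _ cring_A])
  interpret P: cring P by (rule cring_P)
  interpret K: primeideal K P by fact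
  interpret \<pi>: ring_hom_cring P A \<pi> by (rule forcing_algebra_hom)
  interpret J: ideal J P by (rule ideal_J)
  show "ideal (\<pi> ` K) A"
    unfolding forcing_algebra_def by (rule P.ring_ideal_imp_quot_ideal[OF ideal_J K.ideal_axioms])
  have mem: "h \<in> K" if h: "h \<in> carrier P" "\<pi> h \<in> \<pi> ` K" for h
  proof -
    obtain k where k: "k \<in> K" "\<pi> h = \<pi> k" using h by blast
    have "\<pi> (h \<ominus>\<^bsub>P\<^esub> k) = \<zero>\<^bsub>A\<^esub>"
      using k h K.Icarr by (simp add: P.minus_eq \<pi>.S.r_neg)
    moreover have kP: "k \<in> carrier P" using k(1) by (rule K.Icarr)
    then have "h \<ominus>\<^bsub>P\<^esub> k \<in> carrier P" using h(1) by (intro P.minus_closed)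
    ultimately have "h \<ominus>\<^bsub>P\<^esub> k \<in> J" using proj_eq_zero_iff by simp
    then have "h \<ominus>\<^bsub>P\<^esub> k \<in> K" using JK by (rule subsetD[rotated])
    then have "h \<ominus>\<^bsub>P\<^esub> k \<oplus>\<^bsub>P\<^esub> k \<in> K" using k(1) by (rule K.a_closed)
    moreover have "h \<ominus>\<^bsub>P\<^esub> k \<oplus>\<^bsub>P\<^esub> k = h"
      using h(1) kP by (simp add: P.minus_eq P.a_assoc P.l_neg)
    ultimately show ?thesis by simp
  qed
  show "carrier A \<noteq> \<pi> ` K"
  proof
    assume eq: "carrier A = \<pi> ` K"
    have "h \<in> K" if "h \<in> carrier P" for h
      using mem[OF that] \<pi>.hom_closed[OF that] eq by simp
    then show False using K.I_notcarr K.a_subset by blast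
  qed
  fix a b assume "a \<in> carrier A" "b \<in> carrier A" and ab: "a \<otimes>\<^bsub>A\<^esub> b \<in> \<pi> ` K"
  then have "a \<in> \<pi> ` carrier P" "b \<in> \<pi> ` carrier P" unfolding carrier_A by simp_all
  then obtain h k where hk: "h \<in> carrier P" "k \<in> carrier P" "a = \<pi> h" "b = \<pi> k"
    by (elim imageE) simp
  then have "h \<otimes>\<^bsub>P\<^esub> k \<in> K" using ab by (intro mem P.m_closed) simp_all
  then have "h \<in> K \<or> k \<in> K" using hk(1,2) by (intro K.I_prime)
  then show "a \<in> \<pi> ` K \<or> b \<in> \<pi> ` K" using hk(3,4) by blast
qed

lemma forcing_polynomial_in_kernel: "\<pi> F = \<zero>\<^bsub>A\<^esub>"
proof -
  interpret P: cring P by (rule cring_P)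
  have "F \<in> J" unfolding forcing_ideal_def using F_closed P.genideal_self' by blast
  then show ?thesis using proj_eq_zero_iff F_closed by blast
qed

lemma forcing_ideal_eq_multiples: "J = {v \<otimes>\<^bsub>P\<^esub> F |v. v \<in> carrier P}"
proof -
  interpret P: cring P by (rule cring_P)
  show ?thesis
    unfolding forcing_ideal_def P.cgenideal_eq_genideal[OF F_closed, symmetric] cgenideal_def ..
qed

text \<open>If \<open>f\<^sub>i \<noteq> 0\<close>, the polynomial ring in the variables other than \<open>T\<^sub>i\<close> embeds into \<open>A\<close>. Up to powers of
  \<open>f\<^sub>i\<close> it is all of \<open>A\<close>, by \<open>clear_var_from_element\<close> below; these two facts replace the isomorphism of
  \<open>A[1/f\<^sub>i]\<close> with a polynomial ring.\<close>

lemma proj_eq_zero_imp_if_free: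
  assumes i: "i \<in> {1..n}" "f i \<noteq> \<zero>"
    and h: "h \<in> carrier (mpoly_ring R ({1..n} - {i}))" "\<pi> h = \<zero>\<^bsub>A\<^esub>"
  shows "h = \<zero>\<^bsub>P\<^esub>"
proof -
  have "h \<in> carrier P" using h mpoly_carrier_mono[of "{1..n} - {i}" "{1..n}"] by blast
  then have "h \<in> J" using proj_eq_zero_iff h by blast
  then obtain v where "v \<in> carrier P" "h = v \<otimes>\<^bsub>P\<^esub> F" unfolding forcing_ideal_eq_multiples by blast
  then show ?thesis
    using forcing_multiple_free_of_var_eq_zero[of n f g i v] f_closed g_closed i h by blast
qed

lemma clear_var:
  assumes i: "i \<in> {1..n}"
  shows "\<exists>u\<in>carrier (mpoly_ring R ({1..n} - {i})). \<phi> (f i) \<otimes>\<^bsub>A\<^esub> \<pi> (indexed_var i) = \<pi> u"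
proof
  interpret P: cring P by (rule cring_P)
  interpret \<pi>: ring_hom_cring P A \<pi> by (rule forcing_algebra_hom)
  \<comment> \<open>The equation \<open>F = 0\<close> solved for \<open>f\<^sub>i T\<^sub>i\<close>.\<close>
  define u where "u = (\<lambda>m. if m = {#i#} then \<zero> else \<ominus> F m)"
  have Fm: "F m \<in> carrier R" for m using F_closed mpoly_carrier_iff by blast
  have fi: "f i \<in> carrier R" using i by (rule f_closed)
  show u: "u \<in> carrier (mpoly_ring R ({1..n} - {i}))"
  proof -
    have "finite {m. u m \<noteq> \<zero>}"
      by (rule finite_subset[of _ "{m. F m \<noteq> \<zero>}"])
        (use F_closed[unfolded mpoly_carrier_iff] in \<open>auto simp: u_def\<close>)
    moreover have "set_mset m \<subseteq> {1..n} - {i}" if "u m \<noteq> \<zero>" for m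
    proof -
      from that have "m \<noteq> {#i#}" "F m \<noteq> \<zero>" by (auto simp: u_def split: if_splits)
      then show ?thesis using F_support[of m] by auto
    qed
    ultimately show ?thesis unfolding mpoly_carrier_iff using Fm by (auto simp: u_def)
  qed
  then have uP: "u \<in> carrier P" using mpoly_carrier_mono[of "{1..n} - {i}" "{1..n}"] by blast
  have var: "indexed_var i \<in> carrier P" and const: "indexed_const (f i) \<in> carrier P"
    using i fi by (simp_all add: indexed_var_in_mpoly indexed_const_in_mpoly)
  have "indexed_const (f i) \<otimes>\<^bsub>P\<^esub> indexed_var i = (\<lambda>m. if m = {#i#} then f i else \<zero>)"
    by (rule forcing_polynomial_summand[OF f_closed g_closed i])
  also have "\<dots> = F \<oplus>\<^bsub>P\<^esub> u"
    using Fm fi F_linear[OF i] by (auto simp: mpoly_ring_def indexed_padd_def u_def fun_eq_iff r_neg)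
  finally have "indexed_const (f i) \<otimes>\<^bsub>P\<^esub> indexed_var i = F \<oplus>\<^bsub>P\<^esub> u" .
  then have "\<pi> (indexed_const (f i) \<otimes>\<^bsub>P\<^esub> indexed_var i) = \<pi> F \<oplus>\<^bsub>A\<^esub> \<pi> u"
    using uP F_closed by simp
  then show "\<phi> (f i) \<otimes>\<^bsub>A\<^esub> \<pi> (indexed_var i) = \<pi> u"
    unfolding forcing_map_eq forcing_polynomial_in_kernel using var const uP by simp
qed

text \<open>Each factor \<open>T\<^sub>i\<close> of a monomial can be eliminated at the cost of one factor \<open>f\<^sub>i\<close>.\<close>

lemma clear_var_from_element:
  assumes i: "i \<in> {1..n}" and a: "a \<in> carrier A"
  shows "\<exists>d :: nat. \<exists>u\<in>carrier (mpoly_ring R ({1..n} - {i})). \<phi> (f i [^] d) \<otimes>\<^bsub>A\<^esub> a = \<pi> u"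
proof -
  let ?B = "mpoly_ring R ({1..n} - {i})"
  interpret P: cring P by (rule cring_P)
  interpret B: cring ?B by (rule cring_mpoly_ring)
  interpret \<pi>: ring_hom_cring P A \<pi> by (rule forcing_algebra_hom)
  interpret \<phi>: ring_hom_cring R A \<phi> by (rule forcing_map_hom)
  have BP: "u \<in> carrier P" if "u \<in> carrier ?B" for u
    using that mpoly_carrier_mono[of "{1..n} - {i}" "{1..n}"] by blast
  have fi: "f i \<in> carrier R" using i by (rule f_closed)
  have B_const: "\<exists>w\<in>carrier ?B. \<phi> r \<otimes>\<^bsub>A\<^esub> \<pi> u = \<pi> w" if "r \<in> carrier R" "u \<in> carrier ?B" for r u
  proof
    show "indexed_const r \<otimes>\<^bsub>?B\<^esub> u \<in> carrier ?B"
      using that by (simp add: indexed_const_in_mpoly)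
    have "indexed_const r \<otimes>\<^bsub>?B\<^esub> u = indexed_const r \<otimes>\<^bsub>P\<^esub> u" by (simp add: mpoly_ring_def)
    then show "\<phi> r \<otimes>\<^bsub>A\<^esub> \<pi> u = \<pi> (indexed_const r \<otimes>\<^bsub>?B\<^esub> u)"
      unfolding forcing_map_eq using that BP by (simp add: indexed_const_in_mpoly)
  qed
  have B_add: "\<exists>w\<in>carrier ?B. \<pi> u \<oplus>\<^bsub>A\<^esub> \<pi> v = \<pi> w" if "u \<in> carrier ?B" "v \<in> carrier ?B" for u v
  proof
    have "u \<oplus>\<^bsub>?B\<^esub> v = u \<oplus>\<^bsub>P\<^esub> v" by (simp add: mpoly_ring_def)
    then show "\<pi> u \<oplus>\<^bsub>A\<^esub> \<pi> v = \<pi> (u \<oplus>\<^bsub>?B\<^esub> v)" using that BP by simp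
  qed (use that in simp)
  have B_mult: "\<exists>w\<in>carrier ?B. \<pi> u \<otimes>\<^bsub>A\<^esub> \<pi> v = \<pi> w" if "u \<in> carrier ?B" "v \<in> carrier ?B" for u v
  proof
    have "u \<otimes>\<^bsub>?B\<^esub> v = u \<otimes>\<^bsub>P\<^esub> v" by (simp add: mpoly_ring_def)
    then show "\<pi> u \<otimes>\<^bsub>A\<^esub> \<pi> v = \<pi> (u \<otimes>\<^bsub>?B\<^esub> v)" using that BP by simp
  qed (use that in simp)
  have main: "\<exists>d :: nat. \<exists>u\<in>carrier ?B. \<phi> (f i [^] d) \<otimes>\<^bsub>A\<^esub> \<pi> h = \<pi> u"
    if "h \<in> (carrier R [\<X>\<^bsub>{1..n}\<^esub>])" for h
    using that
  proof induction
    case (indexed_const r)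
    then have "\<phi> (f i [^] (0 :: nat)) \<otimes>\<^bsub>A\<^esub> \<pi> (indexed_const r) = \<pi> (indexed_const r)"
      using \<pi>.hom_closed[OF indexed_const_in_mpoly] by simp
    then show ?case using indexed_const_in_mpoly[OF indexed_const] by blast
  next
    case (indexed_padd p q)
    then have pq: "p \<in> carrier P" "q \<in> carrier P" by (simp_all add: mpoly_ring_def)
    from indexed_padd.IH obtain d e :: nat and u v where
      u: "u \<in> carrier ?B" "\<phi> (f i [^] d) \<otimes>\<^bsub>A\<^esub> \<pi> p = \<pi> u" and
      v: "v \<in> carrier ?B" "\<phi> (f i [^] e) \<otimes>\<^bsub>A\<^esub> \<pi> q = \<pi> v" by blast
    let ?c = "\<phi> (f i [^] d)" and ?c' = "\<phi> (f i [^] e)"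
    have c: "?c \<in> carrier A" "?c' \<in> carrier A" using fi by auto
    obtain u' where u': "u' \<in> carrier ?B" "?c' \<otimes>\<^bsub>A\<^esub> \<pi> u = \<pi> u'" using B_const[of "f i [^] e" u] u fi by auto
    obtain v' where v': "v' \<in> carrier ?B" "?c \<otimes>\<^bsub>A\<^esub> \<pi> v = \<pi> v'" using B_const[of "f i [^] d" v] v fi by auto
    have "\<phi> (f i [^] (d + e)) = ?c \<otimes>\<^bsub>A\<^esub> ?c'"
      using fi by (simp add: nat_pow_mult[symmetric])
    moreover have "\<pi> (p \<Oplus> q) = \<pi> p \<oplus>\<^bsub>A\<^esub> \<pi> q"
      using \<pi>.hom_add[OF pq] by (simp add: mpoly_ring_def)
    moreover have "?c \<otimes>\<^bsub>A\<^esub> ?c' \<otimes>\<^bsub>A\<^esub> (\<pi> p \<oplus>\<^bsub>A\<^esub> \<pi> q)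
        = ?c' \<otimes>\<^bsub>A\<^esub> (?c \<otimes>\<^bsub>A\<^esub> \<pi> p) \<oplus>\<^bsub>A\<^esub> ?c \<otimes>\<^bsub>A\<^esub> (?c' \<otimes>\<^bsub>A\<^esub> \<pi> q)"
      using c \<pi>.hom_closed[OF pq(1)] \<pi>.hom_closed[OF pq(2)]
      by (simp add: \<pi>.S.r_distr \<pi>.S.m_ac)
    ultimately have "\<phi> (f i [^] (d + e)) \<otimes>\<^bsub>A\<^esub> \<pi> (p \<Oplus> q) = \<pi> u' \<oplus>\<^bsub>A\<^esub> \<pi> v'"
      using u v u' v' by simp
    then show ?case using B_add[OF u'(1) v'(1)] by metis
  next
    case (indexed_pmult p j)
    then have p: "p \<in> carrier P" by (simp add: mpoly_ring_def)
    have var: "indexed_var j \<in> carrier P" using indexed_pmult by (simp add: indexed_var_in_mpoly)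
    from indexed_pmult.IH obtain d :: nat and u where
      u: "u \<in> carrier ?B" "\<phi> (f i [^] d) \<otimes>\<^bsub>A\<^esub> \<pi> p = \<pi> u" by blast
    let ?c = "\<phi> (f i [^] d)"
    have c: "?c \<in> carrier A" using fi by auto
    have "p \<otimes>\<^bsub>P\<^esub> indexed_var j = p \<Otimes> j"
      using p mpoly_mult_var[of p j] unfolding mpoly_carrier_iff by (simp add: mpoly_ring_def)
    then have proj: "\<pi> (p \<Otimes> j) = \<pi> p \<otimes>\<^bsub>A\<^esub> \<pi> (indexed_var j)"
      using \<pi>.hom_mult[OF p var] by simp
    show ?case
    proof (cases "j = i")
      case False
      have "?c \<otimes>\<^bsub>A\<^esub> \<pi> (p \<Otimes> j) = \<pi> u \<otimes>\<^bsub>A\<^esub> \<pi> (indexed_var j)"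
        unfolding proj u(2)[symmetric] using c \<pi>.hom_closed[OF p] \<pi>.hom_closed[OF var]
        by (simp add: \<pi>.S.m_assoc)
      moreover have "indexed_var j \<in> carrier ?B" using indexed_pmult False by (simp add: indexed_var_in_mpoly)
      ultimately show ?thesis using B_mult[OF u(1)] by metis
    next
      case True
      obtain w where w: "w \<in> carrier ?B" "\<phi> (f i) \<otimes>\<^bsub>A\<^esub> \<pi> (indexed_var i) = \<pi> w"
        using clear_var[OF i] by blast
      have "\<phi> (f i [^] Suc d) = ?c \<otimes>\<^bsub>A\<^esub> \<phi> (f i)" using fi by simp
      then have "\<phi> (f i [^] Suc d) \<otimes>\<^bsub>A\<^esub> \<pi> (p \<Otimes> j) = (?c \<otimes>\<^bsub>A\<^esub> \<pi> p) \<otimes>\<^bsub>A\<^esub> (\<phi> (f i) \<otimes>\<^bsub>A\<^esub> \<pi> (indexed_var j))"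
        unfolding proj using c fi \<pi>.hom_closed[OF p] \<pi>.hom_closed[OF var] \<phi>.hom_closed[OF fi]
        by (simp add: \<pi>.S.m_ac)
      also have "\<dots> = \<pi> u \<otimes>\<^bsub>A\<^esub> \<pi> w" using u w True by simp
      finally show ?thesis using B_mult[OF u(1) w(1)] by metis
    qed
  qed
  obtain h where "h \<in> (carrier R [\<X>\<^bsub>{1..n}\<^esub>])" "a = \<pi> h"
    using a carrier_A by (auto simp: mpoly_ring_def)
  then show ?thesis using main by blast
qed

abbreviation "torsion \<equiv> torsion_elements R \<phi> A"

text \<open>After multiplication by a power of \<open>f\<^sub>i\<close> a torsion element comes from a polynomial ring over the
  domain \<open>R\<close> that embeds into \<open>A\<close>. Such a ring is torsion-free.\<close>

lemma torsion_killed_by_power: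
  assumes i: "i \<in> {1..n}" "f i \<noteq> \<zero>" and a: "a \<in> torsion"
  shows "\<exists>d :: nat. \<phi> (f i [^] d) \<otimes>\<^bsub>A\<^esub> a = \<zero>\<^bsub>A\<^esub>"
proof -
  let ?B = "mpoly_ring R ({1..n} - {i})"
  interpret B: cring ?B by (rule cring_mpoly_ring)
  interpret \<pi>: ring_hom_cring P A \<pi> by (rule forcing_algebra_hom)
  interpret \<phi>: ring_hom_cring R A \<phi> by (rule forcing_map_hom)
  have fi: "f i \<in> carrier R" using i by (intro f_closed)
  obtain r where aA: "a \<in> carrier A" and r: "r \<in> carrier R" "r \<noteq> \<zero>" "\<phi> r \<otimes>\<^bsub>A\<^esub> a = \<zero>\<^bsub>A\<^esub>"
    using a by (auto simp: torsion_elements_def)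
  obtain d :: nat and u where u: "u \<in> carrier ?B" "\<phi> (f i [^] d) \<otimes>\<^bsub>A\<^esub> a = \<pi> u"
    using clear_var_from_element[OF i(1) aA] by blast
  have uP: "u \<in> carrier P" using u mpoly_carrier_mono[of "{1..n} - {i}" "{1..n}"] by blast
  have ru: "indexed_const r \<otimes>\<^bsub>?B\<^esub> u \<in> carrier ?B"
    using u r by (simp add: indexed_const_in_mpoly)
  have "\<pi> (indexed_const r \<otimes>\<^bsub>P\<^esub> u) = \<phi> r \<otimes>\<^bsub>A\<^esub> \<pi> u"
    using r uP by (simp add: forcing_map_eq indexed_const_in_mpoly)
  also have "\<dots> = \<phi> (f i [^] d) \<otimes>\<^bsub>A\<^esub> (\<phi> r \<otimes>\<^bsub>A\<^esub> a)"
    unfolding u(2)[symmetric] using r fi aA by (intro \<pi>.S.m_lcomm) auto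
  also have "\<dots> = \<zero>\<^bsub>A\<^esub>" unfolding r(3) using fi by simp
  finally have "\<pi> (indexed_const r \<otimes>\<^bsub>?B\<^esub> u) = \<zero>\<^bsub>A\<^esub>" by (simp add: mpoly_ring_def)
  then have 0: "indexed_const r \<otimes>\<^bsub>?B\<^esub> u = \<zero>\<^bsub>P\<^esub>" by (rule proj_eq_zero_imp_if_free[OF i ru])
  have um: "u m \<in> carrier R" for m using u mpoly_carrier_iff by blast
  have "u m = \<zero>" for m
  proof -
    have "r \<otimes> u m = (indexed_const r \<otimes>\<^bsub>?B\<^esub> u) m"
      using mpoly_mult_const[of r u m] r(1) um by (simp add: mpoly_ring_def)
    also have "\<dots> = \<zero>" unfolding 0 by (simp add: mpoly_ring_def indexed_const_def)
    finally show ?thesis using r um integral_iff by simp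
  qed
  then have "u = \<zero>\<^bsub>P\<^esub>" by (auto simp: mpoly_ring_def indexed_const_def)
  then show ?thesis using u by auto
qed

text \<open>For primality, multiply both factors by powers of \<open>f\<^sub>i\<close> to make them come from the
  polynomial ring without \<open>T\<^sub>i\<close>, which is a domain.\<close>

lemma torsion_primeideal: "primeideal torsion A"
proof -
  obtain i where i: "i \<in> {1..n}" "f i \<noteq> \<zero>" using f_nonzero by blast
  let ?B = "mpoly_ring R ({1..n} - {i})"
  interpret B: cring ?B by (rule cring_mpoly_ring)
  interpret \<pi>: ring_hom_cring P A \<pi> by (rule forcing_algebra_hom)
  interpret \<phi>: ring_hom_cring R A \<phi> by (rule forcing_map_hom)
  have fi: "f i \<in> carrier R" using i by (intro f_closed)
  have BP: "u \<in> carrier P" if "u \<in> carrier ?B" for u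
    using that mpoly_carrier_mono[of "{1..n} - {i}" "{1..n}"] by blast
  have pow: "f i [^] (d :: nat) \<in> carrier R" "f i [^] (d :: nat) \<noteq> \<zero>" for d
    using fi i by (induction d) (auto simp: integral_iff)
  have mem: "a \<in> torsion" if "a \<in> carrier A" "\<phi> (f i [^] (d :: nat)) \<otimes>\<^bsub>A\<^esub> a = \<zero>\<^bsub>A\<^esub>" for a d
    using that pow[of d] unfolding torsion_elements_def by blast
  have mult: "x \<otimes>\<^bsub>A\<^esub> a \<in> torsion" if a: "a \<in> torsion" and x: "x \<in> carrier A" for a x
  proof -
    obtain r where r: "a \<in> carrier A" "r \<in> carrier R" "r \<noteq> \<zero>" "\<phi> r \<otimes>\<^bsub>A\<^esub> a = \<zero>\<^bsub>A\<^esub>"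
      using a by (auto simp: torsion_elements_def)
    have "\<phi> r \<otimes>\<^bsub>A\<^esub> (x \<otimes>\<^bsub>A\<^esub> a) = x \<otimes>\<^bsub>A\<^esub> (\<phi> r \<otimes>\<^bsub>A\<^esub> a)"
      using r x by (intro \<pi>.S.m_lcomm) auto
    then have "\<phi> r \<otimes>\<^bsub>A\<^esub> (x \<otimes>\<^bsub>A\<^esub> a) = \<zero>\<^bsub>A\<^esub>" unfolding r(4) using x by simp
    then show ?thesis using r x unfolding torsion_elements_def by auto
  qed
  have ideal: "ideal torsion A"
  proof (rule idealI[OF \<pi>.S.ring_axioms])
    show "subgroup torsion (add_monoid A)"
    proof (rule \<pi>.S.add.subgroupI)
      show "torsion \<subseteq> carrier A" unfolding torsion_elements_def by blast
      have "\<zero>\<^bsub>A\<^esub> \<in> torsion" using mem[of "\<zero>\<^bsub>A\<^esub>" 0] by simp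
      then show "torsion \<noteq> {}" by blast
      show "\<ominus>\<^bsub>A\<^esub> a \<in> torsion" if a: "a \<in> torsion" for a
      proof -
        have "a \<in> carrier A" using a unfolding torsion_elements_def by blast
        then have "\<ominus>\<^bsub>A\<^esub> a = (\<ominus>\<^bsub>A\<^esub> \<one>\<^bsub>A\<^esub>) \<otimes>\<^bsub>A\<^esub> a" by (simp add: \<pi>.S.l_minus)
        then show ?thesis using mult[OF a, of "\<ominus>\<^bsub>A\<^esub> \<one>\<^bsub>A\<^esub>"] by simp
      qed
      show "a \<oplus>\<^bsub>A\<^esub> b \<in> torsion" if ab: "a \<in> torsion" "b \<in> torsion" for a b
      proof -
        obtain r where r: "a \<in> carrier A" "r \<in> carrier R" "r \<noteq> \<zero>" "\<phi> r \<otimes>\<^bsub>A\<^esub> a = \<zero>\<^bsub>A\<^esub>"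
          using ab by (auto simp: torsion_elements_def)
        obtain s where s: "b \<in> carrier A" "s \<in> carrier R" "s \<noteq> \<zero>" "\<phi> s \<otimes>\<^bsub>A\<^esub> b = \<zero>\<^bsub>A\<^esub>"
          using ab by (auto simp: torsion_elements_def)
        have c: "\<phi> r \<in> carrier A" "\<phi> s \<in> carrier A" using r s by auto
        have "\<phi> (r \<otimes> s) \<otimes>\<^bsub>A\<^esub> (a \<oplus>\<^bsub>A\<^esub> b) = \<phi> s \<otimes>\<^bsub>A\<^esub> (\<phi> r \<otimes>\<^bsub>A\<^esub> a) \<oplus>\<^bsub>A\<^esub> \<phi> r \<otimes>\<^bsub>A\<^esub> (\<phi> s \<otimes>\<^bsub>A\<^esub> b)"
          using r(1,2) s(1,2) c by (simp add: \<pi>.S.r_distr \<pi>.S.m_ac)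
        also have "\<dots> = \<zero>\<^bsub>A\<^esub>" using r s c by simp
        finally have "\<phi> (r \<otimes> s) \<otimes>\<^bsub>A\<^esub> (a \<oplus>\<^bsub>A\<^esub> b) = \<zero>\<^bsub>A\<^esub>" .
        moreover have "r \<otimes> s \<in> carrier R" "r \<otimes> s \<noteq> \<zero>" using r s integral_iff by auto
        moreover have "a \<oplus>\<^bsub>A\<^esub> b \<in> carrier A" using r s by simp
        ultimately show ?thesis unfolding torsion_elements_def by blast
      qed
    qed
    fix a x assume a: "a \<in> torsion" and x: "x \<in> carrier A"
    from a x show xa: "x \<otimes>\<^bsub>A\<^esub> a \<in> torsion" by (rule mult)
    have "a \<in> carrier A" using a unfolding torsion_elements_def by blast
    then have "a \<otimes>\<^bsub>A\<^esub> x = x \<otimes>\<^bsub>A\<^esub> a" using x by (rule \<pi>.S.m_comm)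
    with xa show "a \<otimes>\<^bsub>A\<^esub> x \<in> torsion" by simp
  qed
  show ?thesis
  proof (rule primeidealI[OF ideal cring_A])
    have "\<one>\<^bsub>A\<^esub> \<notin> torsion"
    proof
      assume "\<one>\<^bsub>A\<^esub> \<in> torsion"
      then obtain r where r: "r \<in> carrier R" "r \<noteq> \<zero>" "\<phi> r \<otimes>\<^bsub>A\<^esub> \<one>\<^bsub>A\<^esub> = \<zero>\<^bsub>A\<^esub>"
        unfolding torsion_elements_def by blast
      then have "\<pi> (indexed_const r) = \<zero>\<^bsub>A\<^esub>" by (simp add: forcing_map_eq[symmetric])
      then have "indexed_const r = \<zero>\<^bsub>P\<^esub>"
        by (rule proj_eq_zero_imp_if_free[OF i indexed_const_in_mpoly[OF r(1)]])
      then have "indexed_const r ({#} :: nat multiset) = \<zero>" by (simp add: mpoly_ring_def indexed_const_def)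
      then show False using r by (simp add: indexed_const_def)
    qed
    then show "carrier A \<noteq> torsion" using \<pi>.S.one_closed by blast
  next
    fix a b assume a: "a \<in> carrier A" and b: "b \<in> carrier A" and ab: "a \<otimes>\<^bsub>A\<^esub> b \<in> torsion"
    obtain d :: nat and u where u: "u \<in> carrier ?B" "\<phi> (f i [^] d) \<otimes>\<^bsub>A\<^esub> a = \<pi> u"
      using clear_var_from_element[OF i(1) a] by blast
    obtain e :: nat and v where v: "v \<in> carrier ?B" "\<phi> (f i [^] e) \<otimes>\<^bsub>A\<^esub> b = \<pi> v"
      using clear_var_from_element[OF i(1) b] by blast
    obtain k :: nat where k: "\<phi> (f i [^] k) \<otimes>\<^bsub>A\<^esub> (a \<otimes>\<^bsub>A\<^esub> b) = \<zero>\<^bsub>A\<^esub>"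
      using torsion_killed_by_power[OF i ab] by blast
    have c: "\<phi> (f i [^] m) \<in> carrier A" for m :: nat using fi by auto
    let ?w = "indexed_const (f i [^] k) \<otimes>\<^bsub>?B\<^esub> (u \<otimes>\<^bsub>?B\<^esub> v)"
    have w: "?w \<in> carrier ?B" using u v fi by (simp add: indexed_const_in_mpoly)
    have "\<pi> ?w = \<pi> (indexed_const (f i [^] k) \<otimes>\<^bsub>P\<^esub> (u \<otimes>\<^bsub>P\<^esub> v))" by (simp add: mpoly_ring_def)
    also have "\<dots> = \<phi> (f i [^] k) \<otimes>\<^bsub>A\<^esub> (\<pi> u \<otimes>\<^bsub>A\<^esub> \<pi> v)"
      unfolding forcing_map_eq using pow(1)[of k] BP[OF u(1)] BP[OF v(1)] by (simp add: indexed_const_in_mpoly)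
    also have "\<dots> = \<phi> (f i [^] d) \<otimes>\<^bsub>A\<^esub> (\<phi> (f i [^] e) \<otimes>\<^bsub>A\<^esub> (\<phi> (f i [^] k) \<otimes>\<^bsub>A\<^esub> (a \<otimes>\<^bsub>A\<^esub> b)))"
      unfolding u(2)[symmetric] v(2)[symmetric] using a b c by (simp add: \<pi>.S.m_ac)
    also have "\<dots> = \<zero>\<^bsub>A\<^esub>" unfolding k using c by simp
    finally have w0: "?w = \<zero>\<^bsub>?B\<^esub>"
      using proj_eq_zero_imp_if_free[OF i w] by (simp add: mpoly_ring_def)
    interpret B: domain ?B
      by (rule domain_mpoly_ring)
    have "indexed_const (f i [^] k) \<noteq> \<zero>\<^bsub>?B\<^esub>"
    proof
      assume "indexed_const (f i [^] k) = \<zero>\<^bsub>?B\<^esub>"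
      then have "indexed_const (f i [^] k) ({#} :: nat multiset) = \<zero>" by (simp add: mpoly_ring_def indexed_const_def)
      then show False using pow by (simp add: indexed_const_def)
    qed
    then have "u = \<zero>\<^bsub>?B\<^esub> \<or> v = \<zero>\<^bsub>?B\<^esub>"
      using w0 u(1) v(1) B.integral_iff indexed_const_in_mpoly[OF pow(1), of k "{1..n} - {i}"] by simp
    moreover have "\<pi> \<zero>\<^bsub>?B\<^esub> = \<zero>\<^bsub>A\<^esub>" using \<pi>.hom_zero by (simp add: mpoly_ring_def)
    ultimately consider "\<pi> u = \<zero>\<^bsub>A\<^esub>" | "\<pi> v = \<zero>\<^bsub>A\<^esub>" by blast
    then show "a \<in> torsion \<or> b \<in> torsion"
    proof cases
      case 1
      then show ?thesis using mem[OF a, of d] u(2) by simp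
    next
      case 2
      then show ?thesis using mem[OF b, of e] v(2) by simp
    qed
  qed
qed

lemma torsion_subset_prime:
  assumes Q: "primeideal Q A" and i: "i \<in> {1..n}" "\<phi> (f i) \<notin> Q"
  shows "torsion \<subseteq> Q"
proof
  interpret Q: primeideal Q A by fact
  interpret \<phi>: ring_hom_cring R A \<phi> by (rule forcing_map_hom)
  have fi: "f i \<in> carrier R" using i by (intro f_closed)
  have "f i \<noteq> \<zero>"
    using i \<phi>.hom_zero additive_subgroup.zero_closed[OF Q.additive_subgroup_axioms] by metis
  fix a assume a: "a \<in> torsion"
  then have aA: "a \<in> carrier A" unfolding torsion_elements_def by blast
  obtain d :: nat where "\<phi> (f i [^] d) \<otimes>\<^bsub>A\<^esub> a = \<zero>\<^bsub>A\<^esub>"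
    using torsion_killed_by_power[OF i(1) \<open>f i \<noteq> \<zero>\<close> a] by blast
  then have "\<phi> (f i [^] d) \<otimes>\<^bsub>A\<^esub> a \<in> Q" by simp
  moreover have "\<phi> (f i [^] d) \<notin> Q" for d :: nat
  proof (induction d)
    case 0
    then show ?case using Q.one_imp_carrier Q.I_notcarr by auto
  next
    case (Suc d)
    then show ?case using Q.I_prime[of "\<phi> (f i [^] d)" "\<phi> (f i)"] fi i by auto
  qed
  ultimately show "a \<in> Q" using Q.I_prime[of "\<phi> (f i [^] d)" a] fi aA by auto
qed

text \<open>Here \<open>\<pp>\<close> is the prime below \<open>Q\<close>. The polynomial \<open>F - g\<close> has coefficients \<open>f\<^sub>i\<close> in \<open>\<pp>\<close>, so its image
  lies in \<open>Q\<close>, and so does that of \<open>g\<close>. Hence \<open>g \<in> \<pp>\<close>, and \<open>F\<close> has all its coefficients in \<open>\<pp>\<close>. So the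
  fibre over \<open>\<pp>\<close> is the one of the polynomial ring, where the polynomials with coefficients in \<open>\<pp>\<close>
  form the smallest prime containing \<open>\<pp>\<close>.\<close>

lemma generic_prime_of_fibre:
  assumes Q: "primeideal Q A" and \<pp>: "primeideal \<pp> R" "\<phi> ` \<pp> \<subseteq> Q"
    and contr: "\<And>r. r \<in> carrier R \<Longrightarrow> \<phi> r \<in> Q \<Longrightarrow> r \<in> \<pp>"
    and fp: "\<And>i. i \<in> {1..n} \<Longrightarrow> f i \<in> \<pp>"
  shows "primeideal (\<pi> ` (\<pp> [\<X>\<^bsub>{1..n}\<^esub>])) A"
    and "\<phi> ` \<pp> \<subseteq> \<pi> ` (\<pp> [\<X>\<^bsub>{1..n}\<^esub>])"
    and "\<And>Q'. primeideal Q' A \<Longrightarrow> \<phi> ` \<pp> \<subseteq> Q' \<Longrightarrow> \<pi> ` (\<pp> [\<X>\<^bsub>{1..n}\<^esub>]) \<subseteq> Q'"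
proof -
  let ?K = "\<pp> [\<X>\<^bsub>{1..n}\<^esub>]"
  interpret P: cring P by (rule cring_P)
  interpret \<pp>: primeideal \<pp> R by fact
  interpret \<pi>: ring_hom_cring P A \<pi> by (rule forcing_algebra_hom)
  have K: "primeideal ?K P" using \<pp>(1) by (rule indexed_pset_primeideal)
  interpret K: primeideal ?K P by fact
  have sub: "\<pi> ` ?K \<subseteq> Q'" if Q': "primeideal Q' A" "\<phi> ` \<pp> \<subseteq> Q'" for Q'
  proof -
    interpret Q': primeideal Q' A by fact
    have "\<pi> h \<in> Q'" if "h \<in> ?K" for h
      using that
    proof induction
      case (indexed_const k)
      then show ?case using Q' forcing_map_eq by auto
    next
      case (indexed_padd p q)
      then have "p \<in> carrier P" "q \<in> carrier P" using K.Icarr by auto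
      then have "\<pi> (p \<Oplus> q) = \<pi> p \<oplus>\<^bsub>A\<^esub> \<pi> q"
        using \<pi>.hom_add by (simp add: mpoly_ring_def)
      then show ?case using indexed_padd by simp
    next
      case (indexed_pmult p j)
      then have p: "p \<in> carrier P" using K.Icarr by auto
      have var: "indexed_var j \<in> carrier P" using indexed_pmult by (simp add: indexed_var_in_mpoly)
      have "p \<otimes>\<^bsub>P\<^esub> indexed_var j = p \<Otimes> j"
        using p mpoly_mult_var[of p j] unfolding mpoly_carrier_iff by (simp add: mpoly_ring_def)
      then have "\<pi> (p \<Otimes> j) = \<pi> p \<otimes>\<^bsub>A\<^esub> \<pi> (indexed_var j)"
        using \<pi>.hom_mult[OF p var] by simp
      then show ?case using indexed_pmult Q'.I_r_closed \<pi>.hom_closed[OF var] by simp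
    qed
    then show ?thesis by blast
  qed
  then show "\<And>Q'. primeideal Q' A \<Longrightarrow> \<phi> ` \<pp> \<subseteq> Q' \<Longrightarrow> \<pi> ` ?K \<subseteq> Q'" .
  show "\<phi> ` \<pp> \<subseteq> \<pi> ` ?K"
    using forcing_map_eq indexed_pset.indexed_const by blast
  have iffK: "p \<in> ?K \<longleftrightarrow> p \<in> carrier P \<and> (\<forall>m. p m \<in> \<pp>)" for p
    unfolding mpoly_carrier_iff indexed_pset_iff[OF \<pp>.additive_subgroup_axioms]
    using \<pp>.a_subset by blast
  define h where "h = F \<ominus>\<^bsub>P\<^esub> indexed_const g"
  have cg: "indexed_const g \<in> carrier P" using g_closed by (rule indexed_const_in_mpoly)
  have h: "h \<in> carrier P" unfolding h_def using cg F_closed by simp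
  have Fh: "F = h \<oplus>\<^bsub>P\<^esub> indexed_const g"
    unfolding h_def using cg F_closed by (simp add: P.minus_eq P.a_assoc P.l_neg)
  have hm: "h m \<in> carrier R" for m using h mpoly_carrier_iff by blast
  have Fm: "F m = h m \<oplus> indexed_const g m" for m
    using Fh by (simp add: mpoly_ring_def indexed_padd_def)
  have "h m \<in> \<pp>" for m
  proof (cases "h m = \<zero>")
    case False
    show ?thesis
    proof (cases "m = {#}")
      case True
      then have "g = h m \<oplus> g"
        using Fm[of m] F_const by (simp add: indexed_const_def)
      then have "h m = \<zero>" using hm g_closed by (metis add.r_cancel_one')
      then show ?thesis by simp
    next
      case m: False
      then have "F m = h m" using Fm hm by (simp add: indexed_const_def)
      then obtain i where "i \<in> {1..n}" "m = {#i#}"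
        using False m F_support[of m] by auto
      then show ?thesis
        using \<open>F m = h m\<close> F_linear fp by metis
    qed
  qed simp
  then have hK: "h \<in> ?K" using h iffK by blast
  interpret Q: primeideal Q A by fact
  have "\<pi> h \<oplus>\<^bsub>A\<^esub> \<phi> g = \<zero>\<^bsub>A\<^esub>"
    using forcing_polynomial_in_kernel h cg unfolding forcing_map_eq by (subst (asm) Fh) simp
  moreover have phg: "\<phi> g \<in> carrier A" unfolding forcing_map_eq using cg by simp
  moreover have phh: "\<pi> h \<in> carrier A" using h by simp
  ultimately have "\<phi> g = \<ominus>\<^bsub>A\<^esub> \<pi> h" by (metis \<pi>.S.minus_equality \<pi>.S.a_comm)
  moreover have "\<pi> h \<in> Q" using sub[OF Q \<pp>(2)] hK by blast
  ultimately have "g \<in> \<pp>" using contr[OF g_closed] by simp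
  then have "indexed_const g \<in> ?K" by (rule indexed_pset.indexed_const)
  then have "F \<in> ?K" using hK unfolding Fh by simp
  then have "J \<subseteq> ?K" unfolding forcing_ideal_eq_multiples using K.I_l_closed by blast
  then show "primeideal (\<pi> ` ?K) A" by (rule proj_image_primeideal[OF K])
qed

end

section \<open>Connectedness of forcing algebras\<close>

theorem corollary5p2:
  fixes R :: "('a, 'b) ring_scheme" (structure)
    and n :: nat and f :: "nat \<Rightarrow> 'a" and g :: 'a
  assumes "noetherian_domain R"
    and "krull_dim R = 1"
    and "\<And>i. i \<in> {1..n} \<Longrightarrow> f i \<in> carrier R"
    and "Idl (f ` {1..n}) \<noteq> {\<zero>}"
    and "g \<in> carrier R"
  shows "connected_spec (forcing_algebra R n f g) \<longleftrightarrow>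
    locally_connected_over R (forcing_map R n f g) (forcing_algebra R n f g)"
proof -
  interpret R: noetherian_domain R by fact
  have "\<exists>i\<in>{1..n}. f i \<noteq> \<zero>"
  proof (rule ccontr)
    assume "\<not> (\<exists>i\<in>{1..n}. f i \<noteq> \<zero>)"
    then have "f ` {1..n} \<subseteq> {\<zero>}" by blast
    then have "Idl (f ` {1..n}) \<subseteq> {\<zero>}" by (rule R.genideal_minimal[OF R.zeroideal])
    moreover have "f ` {1..n} \<subseteq> carrier R" using assms(3) by blast
    then have "\<zero> \<in> Idl (f ` {1..n})"
      by (intro additive_subgroup.zero_closed ideal.axioms(1) R.genideal_ideal)
    ultimately show False using assms(4) by blast
  qed
  then interpret forcing_data R n f g
    using assms(3,5) by (intro forcing_data.intro forcing_data_axioms.intro R.domain_axioms)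
  have "one_dimensional_base R A \<phi>"
  proof (intro one_dimensional_base.intro one_dimensional_base_axioms.intro)
    show "noetherian_domain R" by fact
    show "ring_hom_cring R A \<phi>" by (rule forcing_map_hom)
    show "krull_dim R \<le> 1" using assms(2) by simp
    show "primeideal torsion A" by (rule torsion_primeideal)
    fix Q assume Q: "primeideal Q A" and T: "\<not> torsion \<subseteq> Q"
    let ?\<pp> = "{r \<in> carrier R. \<phi> r \<in> Q}"
    have \<pp>: "primeideal ?\<pp> R" by (rule ring_hom_cring.primeideal_vimage[OF forcing_map_hom Q])
    have f: "f i \<in> ?\<pp>" if i: "i \<in> {1..n}" for i
    proof (rule ccontr)
      assume "f i \<notin> ?\<pp>"
      then have "\<phi> (f i) \<notin> Q" using f_closed[OF i] by simp
      with T show False using torsion_subset_prime[OF Q i] by simp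
    qed
    have "\<phi> ` ?\<pp> \<subseteq> Q" by auto
    note Q0 = generic_prime_of_fibre[OF Q \<pp> this _ f]
    show "\<exists>Q0. primeideal Q0 A \<and> \<phi> ` ?\<pp> \<subseteq> Q0 \<and>
        (\<forall>Q'. primeideal Q' A \<longrightarrow> \<phi> ` ?\<pp> \<subseteq> Q' \<longrightarrow> Q0 \<subseteq> Q')"
      using Q0 by (intro exI[of _ "\<pi> ` (?\<pp> [\<X>\<^bsub>{1..n}\<^esub>])"] conjI allI impI) simp_all
  qed
  then show ?thesis by (rule one_dimensional_base.connected_iff_locally_connected)
qed

end
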